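(* Let $k$ structured subsystems $S_i=(\bar A_i,\bar B_i)$, with $\bar A_i\in\{0,\star\}^{n_i\times n_i}$ and $\bar B_i\in\{0,\star\}^{n_i\times m_i}$, and the neighbor sets $N(S_i)$, $i\in\{1,\dots,k\}$, be given. On this input the two-stage algorithm described in the context returns a set of interconnections such that the composite system obtained using these interconnections is a $2$-optimal solution of the optimal constrained network topology design problem. That is, the returned interconnections are all permitted by the neighbor sets, the resulting composite system is structurally controllable, and their number is at most $2\Delta$, where $\Delta$ is the minimum number of interconnections (over all choices permitted by the neighbor sets) that make the composite system structurally controllable.
   Context: Structured systems: $\bar A\in\{0,\star\}^{n\times n}$ and $\bar B\in\{0,\star\}^{n\times m}$ are zero/nonzero patterns, where each $\star$ is a free independent real parameter. A numerical realization of $(\bar A,\bar B)$ is a pair of real matrices $(A,B)$ with $A_{pq}=0$ whenever $\bar A_{pq}=0$ and $B_{pq}=0$ whenever $\bar B_{pq}=0$. $(\bar A,\bar B)$ is structurally controllable if at least one numerical realization is controllable (as $\dot x=Ax+Bu$). Composite system: there are $k$ subsystems $S_i=(\bar A_i,\bar B_i)$ with states $x^i_1,\dots,x^i_{n_i}$ and inputs $u^i_1,\dots,u^i_{m_i}$. $N(S_j)$ is the given set of (out-)neighbors of $S_j$, i.e. the subsystems to which $S_j$ may send state information (not necessarily a symmetric relation). Let $n_T=\sum_i n_i$. The composite system $(\bar A_T,\bar B_T)$ has block matrix $\bar A_T\in\{0,\star\}^{n_T\times n_T}$ with diagonal blocks $\bar A_i$ and off-diagonal blocks $\bar E_{ij}\in\{0,\star\}^{n_i\times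 n_j}$, where $\bar E_{ij}\ne0$ only if $S_i\in N(S_j)$, and $\bar B_T$ is block diagonal with blocks $\bar B_1,\dots,\bar B_k$. An interconnection $(x^j_q,x^i_p)$, $i\ne j$ (a directed edge from $x^j_q$ to $x^i_p$), corresponds to a $\star$ in entry $(p,q)$ of $\bar E_{ij}$ and is permitted if and only if $S_i\in N(S_j)$. The optimal constrained network topology design problem is to choose the blocks $\bar E_{ij}$ so that $(\bar A_T,\bar B_T)$ is structurally controllable with the minimum number of interconnections (equivalently, so as to minimize the number of nonzero entries of $\bar A_T$). An $\epsilon$-optimal solution is a feasible one whose value is at most $\epsilon$ times the optimum. Standing assumptions: $\bar B_T\neq0$, and establishing all permitted interconnections makes the composite system structurally controllable. Digraphs: $\mathcal D(\bar A_i)$ has vertices $x^i_1,\dots,x^i_{n_i}$ and an edge $(x^i_p,x^i_q)$ whenever $(\bar A_i)_{qp}=\star$; this edge set is $E_{X_i}$. $\mathcal D(\bar A_i,\bar B_i)$ additionally has input vertices $u^i_p$ and edges $(u^i_p,x^i_q)$ whenever $(\bar B_i)_{qp}=\star$. A state is accessible if there is a directed path to it from some input vertex. The algorithm. Stage 1. Form the bipartite graph $\hat{\mathcal B}$ with left vertices $\{x'^i_p\}$ (one for each state of each subsystem), right vertices all states $x^i_q$ and all inputs $u^i_q$, and edge set $\hat{\mathcal E}_S\cup\hat{\mathcal E}_N$. Here $(x'^i_p,x^i_q)\in\hat{\mathcal E}_S$ iff $(\bar A_i)_{pq}=\star$, $(x'^i_p,u^i_q)\in\hat{\mathcal E}_S$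 iff $(\bar B_i)_{pq}=\star$, and $(x'^i_p,x^j_q)\in\hat{\mathcal E}_N$ iff $i\ne j$ and $S_i\in N(S_j)$ (for all $p\le n_i$, $q\le n_j$). Edges in $\hat{\mathcal E}_S$ have weight $0$ and edges in $\hat{\mathcal E}_N$ have weight $1$. Compute a minimum weight perfect matching $M_A$, i.e. a minimum weight matching among those saturating all left vertices. Set $\hat E_N(M_A)=\{(x^j_q,x^i_p):(x'^i_p,x^j_q)\in M_A\cap\hat{\mathcal E}_N\}$. Stage 2. Form the directed graph whose vertices are the strongly connected components $\mathcal N_1,\dots,\mathcal N_Q$ of the digraphs $\mathcal D(\bar A_1),\dots,\mathcal D(\bar A_k)$ together with a master input vertex $\mathbf u$. Its edges are: (a) $E^1$: $(\mathcal N_g,\mathcal N_h)$ whenever there are $x^i_p\in\mathcal N_g$, $x^i_q\in\mathcal N_h$ in the same subsystem with $(x^i_p,x^i_q)\in E_{X_i}$; (b) $E^2$: $(\mathcal N_g,\mathcal N_h)$ whenever $\mathcal N_g$ lies in $S_i$, $\mathcal N_h$ lies in $S_j$, $i\neq j$ and $S_j\in N(S_i)$; (c) $E^3$: $(\mathbf u,\mathcal N_h)$ whenever $\mathcal N_h$ contains a state $x^i_q$ accessible in $\mathcal D(\bar A_i,\bar B_i)$. Edges in $E^1$ and $E^3$ have weight $0$ and edges in $E^2$ have weight $1$. Compute a minimum weight directed spanning tree $T_A$ rooted at $\mathbf u$. For each edge $(\mathcal N_g,\mathcal N_h)\in T_A\cap E^2$ select one interconnection $(x^i_p,x^j_q)$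 with $x^i_p\in\mathcal N_g$, $x^j_q\in\mathcal N_h$; let $\widetilde E(T_A)$ be the set of selected interconnections. Output: $\hat E_N(M_A)\cup\widetilde E(T_A)$. *)

theory Defs
  imports Complex_Main "Graph_Theory.Graph_Theory"
begin

section \<open>Structured systems\<close>

text \<open>
  Matrices are indexed by finite sets \<open>X\<close> (states) and \<open>U\<close> (inputs) rather than by initial
  segments of the naturals, so that composite systems can be indexed by pairs
  (subsystem, index within the subsystem).  A zero/nonzero pattern is a predicate
  that holds exactly at the \<open>\<star>\<close> entries.
\<close>

text \<open>
  Controllability of \<open>x' = A x + B u\<close>: any initial state can be steered to any final state
  in finite time by a continuous input.
\<close>

definition controllable ::
  "'x set \<Rightarrow> 'u set \<Rightarrow> ('x \<Rightarrow> 'x \<Rightarrow> real) \<Rightarrow> ('x \<Rightarrow> 'u \<Rightarrow> real) \<Rightarrow> bool" where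
  "controllable X U A B \<longleftrightarrow>
    (\<forall>x0 x1 :: 'x \<Rightarrow> real. \<exists>T>0. \<exists>(x :: real \<Rightarrow> 'x \<Rightarrow> real) (u :: real \<Rightarrow> 'u \<Rightarrow> real).
       (\<forall>r\<in>U. continuous_on {0..T} (\<lambda>t. u t r)) \<and>
       (\<forall>p\<in>X. \<forall>t\<in>{0..T}.
          ((\<lambda>s. x s p) has_real_derivative
             (\<Sum>q\<in>X. A p q * x t q) + (\<Sum>r\<in>U. B p r * u t r)) (at t within {0..T})) \<and>
       (\<forall>p\<in>X. x 0 p = x0 p \<and> x T p = x1 p))"

definition numerical_realization ::
  "'x set \<Rightarrow> 'u set \<Rightarrow> ('x \<Rightarrow> 'x \<Rightarrow> bool) \<Rightarrow> ('x \<Rightarrow> 'u \<Rightarrow> bool) \<Rightarrow>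
   ('x \<Rightarrow> 'x \<Rightarrow> real) \<Rightarrow> ('x \<Rightarrow> 'u \<Rightarrow> real) \<Rightarrow> bool" where
  "numerical_realization X U PA PB A B \<longleftrightarrow>
    (\<forall>p\<in>X. \<forall>q\<in>X. \<not> PA p q \<longrightarrow> A p q = 0) \<and>
    (\<forall>p\<in>X. \<forall>r\<in>U. \<not> PB p r \<longrightarrow> B p r = 0)"

definition structurally_controllable ::
  "'x set \<Rightarrow> 'u set \<Rightarrow> ('x \<Rightarrow> 'x \<Rightarrow> bool) \<Rightarrow> ('x \<Rightarrow> 'u \<Rightarrow> bool) \<Rightarrow> bool" where
  "structurally_controllable X U PA PB \<longleftrightarrow>
    (\<exists>A B. numerical_realization X U PA PB A B \<and> controllable X U A B)"

section \<open>Composite systems\<close>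

text \<open>
  Subsystems are numbered \<open>0, \<dots>, nsys - 1\<close>; state and input indices also start at \<open>0\<close>.
  Values of the fields outside these ranges are irrelevant.  \<open>nbrs S j\<close> is the set of
  subsystems to which subsystem \<open>j\<close> may send state information.
\<close>

record network =
  nsys :: nat
  sdim :: "nat \<Rightarrow> nat"
  idim :: "nat \<Rightarrow> nat"
  Apat :: "nat \<Rightarrow> nat \<Rightarrow> nat \<Rightarrow> bool"
  Bpat :: "nat \<Rightarrow> nat \<Rightarrow> nat \<Rightarrow> bool"
  nbrs :: "nat \<Rightarrow> nat set"

type_synonym state = "nat \<times> nat"
type_synonym input = "nat \<times> nat"

text \<open>An interconnection is a directed edge (source state, target state).\<close>

type_synonym interconnection = "state \<times> state"

definition states :: "network \<Rightarrow> state set" where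
  "states S = {(i, p). i < nsys S \<and> p < sdim S i}"

definition inputs :: "network \<Rightarrow> input set" where
  "inputs S = {(i, r). i < nsys S \<and> r < idim S i}"

definition permitted :: "network \<Rightarrow> interconnection set" where
  "permitted S = {((j, q), (i, p)) | i j p q.
     (i, p) \<in> states S \<and> (j, q) \<in> states S \<and> i \<noteq> j \<and> i \<in> nbrs S j}"

fun composite_A :: "network \<Rightarrow> interconnection set \<Rightarrow> state \<Rightarrow> state \<Rightarrow> bool" where
  "composite_A S F (i, p) (j, q) \<longleftrightarrow>
     (if i = j then Apat S i p q else ((j, q), (i, p)) \<in> F)"

fun composite_B :: "network \<Rightarrow> state \<Rightarrow> input \<Rightarrow> bool" where
  "composite_B S (i, p) (j, r) \<longleftrightarrow> i = j \<and> Bpat S i p r"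

definition feasible :: "network \<Rightarrow> interconnection set \<Rightarrow> bool" where
  "feasible S F \<longleftrightarrow> F \<subseteq> permitted S \<and>
     structurally_controllable (states S) (inputs S) (composite_A S F) (composite_B S)"

definition min_interconnections :: "network \<Rightarrow> nat" where
  "min_interconnections S = Min (card ` {F. feasible S F})"

definition eps_optimal :: "network \<Rightarrow> real \<Rightarrow> interconnection set \<Rightarrow> bool" where
  "eps_optimal S \<epsilon> F \<longleftrightarrow>
     feasible S F \<and> real (card F) \<le> \<epsilon> * real (min_interconnections S)"

section \<open>Stage 1: minimum weight perfect matching\<close>

text \<open>
  Left vertices are states (rows of the composite matrices); right vertices are
  states (\<open>Inl\<close>) and inputs (\<open>Inr\<close>).
\<close>

type_synonym bip_edge = "state \<times> (state + input)"

definition bip_local :: "network \<Rightarrow> bip_edge set" where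
  "bip_local S =
     {((i, p), Inl (i, q)) | i p q. (i, p) \<in> states S \<and> (i, q) \<in> states S \<and> Apat S i p q} \<union>
     {((i, p), Inr (i, r)) | i p r. (i, p) \<in> states S \<and> (i, r) \<in> inputs S \<and> Bpat S i p r}"

definition bip_nbr :: "network \<Rightarrow> bip_edge set" where
  "bip_nbr S = {((i, p), Inl (j, q)) | i j p q.
     (i, p) \<in> states S \<and> (j, q) \<in> states S \<and> i \<noteq> j \<and> i \<in> nbrs S j}"

definition perfect_matching :: "network \<Rightarrow> bip_edge set \<Rightarrow> bool" where
  "perfect_matching S M \<longleftrightarrow>
     M \<subseteq> bip_local S \<union> bip_nbr S \<and> inj_on fst M \<and> inj_on snd M \<and> fst ` M = states S"

definition matching_weight :: "network \<Rightarrow> bip_edge set \<Rightarrow> nat" where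
  "matching_weight S M = (\<Sum>e\<in>M. if e \<in> bip_nbr S then 1 else 0)"

definition min_weight_perfect_matching :: "network \<Rightarrow> bip_edge set \<Rightarrow> bool" where
  "min_weight_perfect_matching S M \<longleftrightarrow> is_arg_min (matching_weight S) (perfect_matching S) M"

definition matching_interconnections :: "network \<Rightarrow> bip_edge set \<Rightarrow> interconnection set" where
  "matching_interconnections S M = {(y, x) | x y. (x, Inl y) \<in> M \<inter> bip_nbr S}"

section \<open>Stage 2: minimum weight directed spanning tree\<close>

text \<open>Column \<open>p\<close>, row \<open>q\<close> of a pattern gives the edge from vertex \<open>p\<close> to vertex \<open>q\<close>.\<close>

definition state_digraph :: "network \<Rightarrow> nat \<Rightarrow> state pair_pre_digraph" where
  "state_digraph S i = \<lparr>
     pverts = {(i, p) | p. p < sdim S i},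
     parcs = {((i, p), (i, q)) | p q. p < sdim S i \<and> q < sdim S i \<and> Apat S i q p} \<rparr>"

definition system_digraph :: "network \<Rightarrow> nat \<Rightarrow> (state + input) pair_pre_digraph" where
  "system_digraph S i = \<lparr>
     pverts = {Inl (i, p) | p. p < sdim S i} \<union> {Inr (i, r) | r. r < idim S i},
     parcs =
       {(Inl (i, p), Inl (i, q)) | p q. p < sdim S i \<and> q < sdim S i \<and> Apat S i q p} \<union>
       {(Inr (i, r), Inl (i, q)) | r q. r < idim S i \<and> q < sdim S i \<and> Bpat S i q r} \<rparr>"

definition locally_accessible :: "network \<Rightarrow> state \<Rightarrow> bool" where
  "locally_accessible S x \<longleftrightarrow>
     (\<exists>r < idim S (fst x). Inr (fst x, r) \<rightarrow>\<^sup>*\<^bsub>with_proj (system_digraph S (fst x))\<^esub> Inl x)"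

definition components :: "network \<Rightarrow> nat \<Rightarrow> state set set" where
  "components S i = pre_digraph.sccs_verts (with_proj (state_digraph S i))"

datatype vertex = Master | Comp "state set"

definition edges1 :: "network \<Rightarrow> (vertex \<times> vertex) set" where
  "edges1 S = {(Comp C, Comp D) | C D i x y. i < nsys S \<and>
     C \<in> components S i \<and> D \<in> components S i \<and> x \<in> C \<and> y \<in> D \<and>
     (x, y) \<in> parcs (state_digraph S i)}"

definition edges2 :: "network \<Rightarrow> (vertex \<times> vertex) set" where
  "edges2 S = {(Comp C, Comp D) | C D i j. i < nsys S \<and> j < nsys S \<and>
     C \<in> components S i \<and> D \<in> components S j \<and> i \<noteq> j \<and> j \<in> nbrs S i}"

definition edges3 :: "network \<Rightarrow> (vertex \<times> vertex) set" where
  "edges3 S = {(Master, Comp D) | D i x. i < nsys S \<and>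
     D \<in> components S i \<and> x \<in> D \<and> locally_accessible S x}"

definition component_digraph :: "network \<Rightarrow> vertex pair_pre_digraph" where
  "component_digraph S = \<lparr>
     pverts = insert Master (Comp ` (\<Union>i<nsys S. components S i)),
     parcs = edges1 S \<union> edges2 S \<union> edges3 S \<rparr>"

definition directed_spanning_tree ::
  "'v pair_pre_digraph \<Rightarrow> 'v \<Rightarrow> ('v \<times> 'v) set \<Rightarrow> bool" where
  "directed_spanning_tree G r T \<longleftrightarrow> T \<subseteq> parcs G \<and>
     (let H = with_proj \<lparr> pverts = pverts G, parcs = T \<rparr> in
        in_degree H r = 0 \<and>
        (\<forall>v \<in> verts H - {r}. in_degree H v = 1) \<and>
        (\<forall>v \<in> verts H. r \<rightarrow>\<^sup>*\<^bsub>H\<^esub> v))"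

definition tree_weight :: "network \<Rightarrow> (vertex \<times> vertex) set \<Rightarrow> nat" where
  "tree_weight S T = (\<Sum>e\<in>T. if e \<in> edges2 S then 1 else 0)"

definition min_weight_spanning_tree :: "network \<Rightarrow> (vertex \<times> vertex) set \<Rightarrow> bool" where
  "min_weight_spanning_tree S T \<longleftrightarrow>
     is_arg_min (tree_weight S) (directed_spanning_tree (component_digraph S) Master) T"

definition tree_selection ::
  "network \<Rightarrow> (vertex \<times> vertex) set \<Rightarrow> (vertex \<times> vertex \<Rightarrow> interconnection) \<Rightarrow> bool" where
  "tree_selection S T sel \<longleftrightarrow>
     (\<forall>C D. (Comp C, Comp D) \<in> T \<inter> edges2 S \<longrightarrow> sel (Comp C, Comp D) \<in> C \<times> D)"

text \<open>
  The algorithm is nondeterministic (choice of matching, of tree and of the selected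
  interconnections), so it is a relation between inputs and possible outputs.
\<close>

definition algorithm_output :: "network \<Rightarrow> interconnection set \<Rightarrow> bool" where
  "algorithm_output S F \<longleftrightarrow>
     (\<exists>M T sel. min_weight_perfect_matching S M \<and> min_weight_spanning_tree S T \<and>
        tree_selection S T sel \<and>
        F = matching_interconnections S M \<union> sel ` (T \<inter> edges2 S))"

end

theory Submission
  imports Defs "HOL-Computational_Algebra.Polynomial"
begin

text \<open>
  By Lin's theorem a structured system is structurally controllable iff every state is accessible
  from an input and the rows of \<open>[A B]\<close> can be matched into the columns along \<open>\<star>\<close> entries.  The
  matching stage secures the second condition and the tree stage the first, and adding further
  interconnections destroys neither.  Conversely, an optimal solution satisfies both conditions, so it
  contains the interconnections of some perfect matching and induces those of some spanning tree;
  hence each stage costs at most the optimum.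

  Lin's theorem is proved directly for the trajectory notion of controllability.  For necessity, the
  inaccessible states solve an autonomous linear equation, and the left kernel of \<open>[A B]\<close> gives
  conserved quantities.  For sufficiency, the matching splits the states into chains starting at
  inputs and cycles; the cycles are attached one at a time by an entering edge, with a large gain on
  each new cycle.  The resulting realization steers any state to any other by polynomial inputs.
\<close>

section \<open>Linear algebra over a finite index set\<close>

text \<open>One good realization is enough, so it can be built by hand: all chosen edges get weight
  1 except those of the later cycles, whose gain is the only quantity to tune. What forces the
  tuning is resonance: a cycle that shares modes with the part already built may carry a signal that
  never shows at the inputs. Row iterates around a cycle of length \<open>L\<close> and gain
  \<open>a\<close> satisfy \<open>v (k + L) = a ^ L * v k\<close>; dividing by \<open>a ^ k\<close>
  makes them periodic, so suprema are attained and norm estimates can replace eigenvalues.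

  The passage from the algebraic condition to trajectories is also algebraic. A polynomial curve
  with the prescribed end values violates the state equation by a polynomial residual, which is
  corrected by polynomial trajectories vanishing at both end times. Each multiplication by
  \<open>A\<close> costs one derivative of the residual, which is why the curve must first be
  improved until its residual vanishes to high order at both ends.\<close>

lemma independent_rows_matching:
  fixes W :: "'x \<Rightarrow> 'y \<Rightarrow> real"
  assumes "finite X" "finite Y"
    and "\<And>v. \<forall>y\<in>Y. (\<Sum>p\<in>X. v p * W p y) = 0 \<Longrightarrow> \<forall>p\<in>X. v p = 0"
  shows "\<exists>f. inj_on f X \<and> (\<forall>p\<in>X. f p \<in> Y \<and> W p (f p) \<noteq> 0)"
  using assms
proof (induction X arbitrary: Y rule: finite_induct)
  case empty
  then show ?case by simp
next
  case (insert p X)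
  \<comment> \<open>As in the expansion of a determinant along row \<open>p\<close>, a column with
    nonzero entry is sought whose removal keeps the other rows independent.\<close>
  have "\<exists>y\<in>Y. W p y \<noteq> 0 \<and>
      (\<forall>v. (\<forall>y'\<in>Y - {y}. (\<Sum>q\<in>X. v q * W q y') = 0) \<longrightarrow> (\<forall>q\<in>X. v q = 0))"
  proof (rule ccontr)
    assume "\<not> ?thesis"
    then have "\<forall>y. \<exists>v. y \<in> Y \<and> W p y \<noteq> 0 \<longrightarrow>
        (\<forall>y'\<in>Y - {y}. (\<Sum>q\<in>X. v q * W q y') = 0) \<and> (\<exists>q\<in>X. v q \<noteq> 0)"
      by blast
    from choice[OF this] obtain V where V: "y \<in> Y \<Longrightarrow> W p y \<noteq> 0 \<Longrightarrow>
        (\<forall>y'\<in>Y - {y}. (\<Sum>q\<in>X. V y q * W q y') = 0) \<and> (\<exists>q\<in>X. V y q \<noteq> 0)" for y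
      by blast
    \<comment> \<open>\<open>V y\<close> combines the rows in \<open>X\<close> into
      \<open>c y\<close> times the unit vector at column \<open>y\<close>.\<close>
    define c where "c y = (\<Sum>q\<in>X. V y q * W q y)" for y
    have c: "c y \<noteq> 0" if y: "y \<in> Y" "W p y \<noteq> 0" for y
    proof
      assume "c y = 0"
      then have 0: "(\<Sum>q\<in>X. V y q * W q y') = 0" if "y' \<in> Y" for y'
        using V[OF y] that unfolding c_def by (cases "y' = y") auto
      have "\<forall>y'\<in>Y. (\<Sum>q\<in>insert p X. ((V y)(p := 0)) q * W q y') = 0"
      proof
        fix y' assume "y' \<in> Y"
        have "(\<Sum>q\<in>insert p X. ((V y)(p := 0)) q * W q y') =
            (\<Sum>q\<in>X. ((V y)(p := 0)) q * W q y')"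
          using insert.hyps by simp
        also have "\<dots> = (\<Sum>q\<in>X. V y q * W q y')"
          using insert.hyps by (intro sum.cong) auto
        finally show "(\<Sum>q\<in>insert p X. ((V y)(p := 0)) q * W q y') = 0"
          using 0[OF \<open>y' \<in> Y\<close>] by simp
      qed
      from insert.prems(2)[OF this] have "\<forall>q\<in>X. V y q = 0"
        using insert.hyps by (metis fun_upd_other insertI2)
      then show False using V[OF y] by blast
    qed
    define Z where "Z = {y \<in> Y. W p y \<noteq> 0}"
    have Z: "finite Z" using insert.prems(1) by (simp add: Z_def)
    \<comment> \<open>If every candidate column failed, each unit vector at a nonzero entry of row
      \<open>p\<close> would be a combination of the other rows. Then so would row \<open>p\<close>,
      and \<open>v\<close> records that dependence.\<close>
    define v where "v q = (if q = p then 1 else - (\<Sum>y\<in>Z. W p y / c y * V y q))" for q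
    have "\<forall>y'\<in>Y. (\<Sum>q\<in>insert p X. v q * W q y') = 0"
    proof
      fix y' assume y': "y' \<in> Y"
      have inner: "(\<Sum>q\<in>X. V y q * W q y') = (if y = y' then c y else 0)" if "y \<in> Z" for y
        using V[of y] that y' by (auto simp: Z_def c_def)
      have "(\<Sum>q\<in>X. v q * W q y') = (\<Sum>q\<in>X. - (\<Sum>y\<in>Z. W p y / c y * V y q) * W q y')"
        using insert.hyps by (intro sum.cong) (auto simp: v_def)
      also have "\<dots> = - (\<Sum>q\<in>X. \<Sum>y\<in>Z. W p y / c y * (V y q * W q y'))"
        by (simp add: sum_negf sum_distrib_right sum_distrib_left mult.assoc)
      also have "\<dots> = - (\<Sum>y\<in>Z. W p y / c y * (\<Sum>q\<in>X. V y q * W q y'))"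
        by (subst sum.swap) (simp add: sum_distrib_left)
      also have "\<dots> = - (\<Sum>y\<in>Z. if y = y' then W p y else 0)"
        using c by (intro arg_cong[where f = uminus] sum.cong) (auto simp: inner Z_def)
      also have "\<dots> = - W p y'"
        using Z y' by (simp add: sum.delta') (auto simp: Z_def)
      finally show "(\<Sum>q\<in>insert p X. v q * W q y') = 0"
        using insert.hyps by (simp add: v_def)
    qed
    from insert.prems(2)[OF this] have "v p = 0" by blast
    then show False by (simp add: v_def)
  qed
  then obtain y where y: "y \<in> Y" "W p y \<noteq> 0"
    and indep: "\<And>v. \<forall>y'\<in>Y - {y}. (\<Sum>q\<in>X. v q * W q y') = 0 \<Longrightarrow> \<forall>q\<in>X. v q = 0"
    by blast
  have "finite (Y - {y})" using insert.prems(1) by simp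
  from insert.IH[OF this indep]
  obtain f where f: "inj_on f X" "\<forall>q\<in>X. f q \<in> Y - {y} \<and> W q (f q) \<noteq> 0"
    by blast
  have "inj_on (f(p := y)) (insert p X)"
    using f insert.hyps by (auto simp: inj_on_def)
  moreover have "\<forall>q\<in>insert p X. (f(p := y)) q \<in> Y \<and> W q ((f(p := y)) q) \<noteq> 0"
    using f y by auto
  ultimately show ?case by blast
qed

text \<open>Finite-dimensional duality: a subspace without nonzero annihilator is the whole space.
  In the induction \<open>K\<close> splits into its part vanishing at \<open>r\<close> and the
  multiples of one vector with value 1 there.\<close>

lemma unit_vectors_in_annihilator_free_subspace:
  fixes K :: "('x \<Rightarrow> real) set"
  assumes "finite X"
    and "\<And>v w. v \<in> K \<Longrightarrow> w \<in> K \<Longrightarrow> (\<lambda>p. v p + w p) \<in> K"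
    and "\<And>c v. v \<in> K \<Longrightarrow> (\<lambda>p. c * v p) \<in> K"
    and "\<And>w. \<forall>v\<in>K. (\<Sum>p\<in>X. w p * v p) = 0 \<Longrightarrow> \<forall>p\<in>X. w p = 0"
    and "p \<in> X"
  shows "\<exists>v\<in>K. \<forall>q\<in>X. v q = (if q = p then 1 else 0)"
  using assms
proof (induction X arbitrary: K p rule: finite_induct)
  case empty
  then show ?case by simp
next
  case (insert r X)
  note add = insert.prems(1) and scale = insert.prems(2) and ann = insert.prems(3)
  have "\<exists>v\<in>K. v r \<noteq> 0"
  proof (rule ccontr)
    assume "\<not> ?thesis"
    then have "\<forall>v\<in>K. (\<Sum>q\<in>insert r X. (if q = r then 1 else 0) * v q) = 0"
      by (intro ballI sum.neutral) auto
    from ann[OF this] show False by auto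
  qed
  then obtain v1 where "v1 \<in> K" "v1 r \<noteq> 0" by blast
  then obtain v0 where v0: "v0 \<in> K" "v0 r = 1"
    using scale[of v1 "1 / v1 r"] by fastforce
  define K' where "K' = {v \<in> K. v r = 0}"
  have unit: "\<exists>v\<in>K'. \<forall>q\<in>X. v q = (if q = p then 1 else 0)" if "p \<in> X" for p
  proof (rule insert.IH)
    fix w assume w: "\<forall>v\<in>K'. (\<Sum>p\<in>X. w p * v p) = 0"
    \<comment> \<open>The entry at \<open>r\<close> is chosen so that \<open>w'\<close> annihilates
      \<open>v0\<close> as well; with \<open>v0\<close> and \<open>K'\<close> it annihilates all of
      \<open>K\<close>.\<close>
    define w' where "w' q = (if q = r then - (\<Sum>p\<in>X. w p * v0 p) else w q)" for q
    have "\<forall>v\<in>K. (\<Sum>q\<in>insert r X. w' q * v q) = 0"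
    proof
      fix v assume v: "v \<in> K"
      have in_K': "(\<lambda>q. v q + (- v r) * v0 q) \<in> K'"
        using add[OF v scale[OF v0(1), of "- v r"]] v0(2) by (simp add: K'_def)
      have "(\<Sum>p\<in>X. w p * (v p + (- v r) * v0 p)) = 0"
        using bspec[OF w in_K'] .
      moreover have "(\<Sum>p\<in>X. w p * (v p + (- v r) * v0 p)) =
          (\<Sum>p\<in>X. w p * v p) - v r * (\<Sum>p\<in>X. w p * v0 p)"
        unfolding sum_distrib_left sum_subtractf[symmetric]
        by (intro sum.cong) (auto simp: algebra_simps)
      ultimately have "(\<Sum>p\<in>X. w p * v p) = v r * (\<Sum>p\<in>X. w p * v0 p)"
        by linarith
      moreover have "(\<Sum>q\<in>X. w' q * v q) = (\<Sum>p\<in>X. w p * v p)"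
        using insert.hyps by (intro sum.cong) (auto simp: w'_def)
      ultimately show "(\<Sum>q\<in>insert r X. w' q * v q) = 0"
        using insert.hyps by (simp add: w'_def)
    qed
    note w'0 = ann[OF this]
    show "\<forall>p\<in>X. w p = 0"
    proof
      fix p assume "p \<in> X"
      then have "w' p = 0" "p \<noteq> r" using w'0 insert.hyps(2) by auto
      then show "w p = 0" by (simp add: w'_def)
    qed
  next
    show "(\<lambda>p. v p + w p) \<in> K'" if "v \<in> K'" "w \<in> K'" for v w
      using add[of v w] that by (simp add: K'_def)
    show "(\<lambda>p. c * v p) \<in> K'" if "v \<in> K'" for c v
      using scale[of v c] that by (simp add: K'_def)
  qed (rule that)
  show ?case
  proof (cases "p = r")
    case False
    with insert.prems(4) have "p \<in> X" by simp
    from unit[OF this] obtain v where "v \<in> K'" "\<forall>q\<in>X. v q = (if q = p then 1 else 0)" ..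
    then show ?thesis using False by (intro bexI[of _ v]) (auto simp: K'_def)
  next
    case True
    have "\<forall>p\<in>X. \<exists>v. v \<in> K' \<and> (\<forall>q\<in>X. v q = (if q = p then 1 else 0))"
      using unit by blast
    from bchoice[OF this] obtain e where e: "\<And>p. p \<in> X \<Longrightarrow> e p \<in> K'"
      "\<And>p q. p \<in> X \<Longrightarrow> q \<in> X \<Longrightarrow> e p q = (if q = p then 1 else 0)"
      by blast
    \<comment> \<open>Removing from \<open>v0\<close> its coordinates on \<open>X\<close> leaves the
      unit vector at \<open>r\<close>. Partial sums over \<open>Z\<close> allow closure under
      addition to be applied one term at a time.\<close>
    have sum_in: "(\<lambda>q. v0 q + (\<Sum>p\<in>Z. (- v0 p) * e p q)) \<in> K" if "Z \<subseteq> X" for Z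
      using finite_subset[OF that insert.hyps(1)] that
    proof (induction Z rule: finite_induct)
      case (insert p Z)
      have "p \<in> X" using insert.prems by simp
      then have "e p \<in> K" using e(1)[of p] by (simp add: K'_def)
      from scale[OF this] have "(\<lambda>q. (- v0 p) * e p q) \<in> K" .
      from add[OF insert.IH this] insert.prems
      have "(\<lambda>q. v0 q + (\<Sum>p\<in>Z. (- v0 p) * e p q) + (- v0 p) * e p q) \<in> K" by simp
      also have "(\<lambda>q. v0 q + (\<Sum>p\<in>Z. (- v0 p) * e p q) + (- v0 p) * e p q) =
          (\<lambda>q. v0 q + (\<Sum>p\<in>insert p Z. (- v0 p) * e p q))"
        using insert.hyps by (simp add: fun_eq_iff)
      finally show ?case .
    qed (use v0 in simp)
    have "v0 q + (\<Sum>p\<in>X. (- v0 p) * e p q) = (if q = r then 1 else 0)"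
      if q: "q \<in> insert r X" for q
    proof (cases "q = r")
      case True
      have "(\<Sum>p\<in>X. (- v0 p) * e p r) = 0"
        using e(1) by (intro sum.neutral) (auto simp: K'_def)
      then show ?thesis using True v0 by simp
    next
      case False
      with q have "q \<in> X" by simp
      have "(\<Sum>p\<in>X. (- v0 p) * e p q) = (\<Sum>p\<in>X. if q = p then - v0 p else 0)"
        using e(2) \<open>q \<in> X\<close> by (intro sum.cong) auto
      also have "\<dots> = - v0 q" using \<open>q \<in> X\<close> insert.hyps by simp
      finally show ?thesis using False by simp
    qed
    then show ?thesis unfolding True by (intro bexI[OF _ sum_in[OF subset_refl]]) simp
  qed
qed

section \<open>Realizations without hidden modes\<close>

text \<open>
  Kalman's rank condition in dual form, with the inputs \<open>U\<close> as additional vertices: the left iterates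
  of a nonzero row vector cannot all vanish on \<open>U\<close>.
\<close>

definition input_observable :: "'y set \<Rightarrow> 'y set \<Rightarrow> ('y \<Rightarrow> 'y \<Rightarrow> real) \<Rightarrow> bool" where
  "input_observable Y U M \<longleftrightarrow>
    (\<forall>v :: nat \<Rightarrow> 'y \<Rightarrow> real.
       (\<forall>k. \<forall>q\<in>Y. v (Suc k) q = (\<Sum>p\<in>Y. v k p * M p q)) \<longrightarrow>
       (\<forall>k. \<forall>u\<in>U. v k u = 0) \<longrightarrow> (\<forall>q\<in>Y. v 0 q = 0))"

text \<open>The equations are invariant under time shifts, so vanishing at time 0 extends to every
  time.\<close>

lemma input_observableD:
  assumes "input_observable Y U M"
    and "\<And>k q. q \<in> Y \<Longrightarrow> v (Suc k) q = (\<Sum>p\<in>Y. v k p * M p q)"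
    and "\<And>k u. u \<in> U \<Longrightarrow> v k u = 0"
    and "q \<in> Y"
  shows "v k q = 0"
  using assms(1)[unfolded input_observable_def, rule_format, of "\<lambda>j. v (j + k)" q] assms(2-4)
  by simp

text \<open>
  The impulse response from \<open>z\<close> to the inputs is nonzero, say first at step \<open>\<kappa>\<close>.  Hence, for a large
  gain \<open>a\<close>, a periodic signal \<open>c\<close> that is fed in at \<open>z\<close> and never shows at the inputs must vanish:
  the response to \<open>c\<close> has size at most \<open>sup |c| / (a - n)\<close>, whereas the \<open>\<kappa>\<close>-th output equation bounds
  \<open>sup |c|\<close> by a fixed multiple of that size.
\<close>

lemma large_gain_hides_no_periodic_signal:
  fixes M :: "'y \<Rightarrow> 'y \<Rightarrow> real"
  assumes fin: "finite Y" and U: "U \<subseteq> Y" and obs: "input_observable Y U M" and z: "z \<in> Y"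
  obtains a where "a > 0"
    and "\<And>L (x :: nat \<Rightarrow> 'y \<Rightarrow> real) (c :: nat \<Rightarrow> real) k. L > 0 \<Longrightarrow>
      (\<And>k. c (k + L) = c k) \<Longrightarrow> (\<And>k q. q \<in> Y \<Longrightarrow> x (k + L) q = x k q) \<Longrightarrow>
      (\<And>k q. q \<in> Y \<Longrightarrow>
        a * x (Suc k) q = (\<Sum>p\<in>Y. x k p * M p q) + (if q = z then c k else 0)) \<Longrightarrow>
      (\<And>k u. u \<in> U \<Longrightarrow> x k u = 0) \<Longrightarrow> c k = 0"
proof -
  define push where "push w q = (\<Sum>p\<in>Y. w p * M p q)" for w :: "'y \<Rightarrow> real" and q
  define g where "g j = (push ^^ j) (\<lambda>q. if q = z then 1 else 0)" for j
  have g_Suc: "g (Suc j) q = (\<Sum>p\<in>Y. g j p * M p q)" for j q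
    by (simp add: g_def push_def)
  have "\<exists>j. \<exists>u\<in>U. g j u \<noteq> 0"
  proof (rule ccontr)
    assume "\<not> ?thesis"
    then have "g j u = 0" if "u \<in> U" for j u using that by blast
    from input_observableD[of Y U M g z 0, OF obs g_Suc this z] have "g 0 z = 0" .
    then show False by (simp add: g_def)
  qed
  then obtain \<kappa> where \<kappa>: "\<exists>u\<in>U. g \<kappa> u \<noteq> 0" and below: "\<And>j u. j < \<kappa> \<Longrightarrow> u \<in> U \<Longrightarrow> g j u = 0"
    using exists_least_iff[of "\<lambda>j. \<exists>u\<in>U. g j u \<noteq> 0"] by blast
  then obtain u where u: "u \<in> U" "g \<kappa> u \<noteq> 0" by blast
  \<comment> \<open>A bound for \<open>push\<close> in the maximum norm; the summand 1 keeps its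
    powers positive.\<close>
  define n where "n = 1 + (\<Sum>p\<in>Y. \<Sum>q\<in>Y. \<bar>M p q\<bar>)"
  have n: "n \<ge> 1" by (simp add: n_def sum_nonneg)
  have push_le: "\<bar>push w q\<bar> \<le> n * m" if "\<And>p. p \<in> Y \<Longrightarrow> \<bar>w p\<bar> \<le> m" "q \<in> Y" "m \<ge> 0" for w q m
  proof -
    have "\<bar>push w q\<bar> \<le> (\<Sum>p\<in>Y. \<bar>w p * M p q\<bar>)" by (simp add: push_def sum_abs)
    also have "\<dots> \<le> (\<Sum>p\<in>Y. m * \<bar>M p q\<bar>)"
      using that by (intro sum_mono) (auto simp: abs_mult intro: mult_right_mono)
    also have "\<dots> \<le> (\<Sum>p\<in>Y. m * (\<Sum>q\<in>Y. \<bar>M p q\<bar>))"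
      using that fin by (intro sum_mono mult_left_mono member_le_sum) auto
    also have "\<dots> \<le> n * m"
      using that(3) by (simp add: n_def sum_distrib_left[symmetric] algebra_simps)
    finally show ?thesis .
  qed
  \<comment> \<open>\<open>d\<close> is the factor in the bound of \<open>\<bar>c k\<bar>\<close> by
    the size \<open>m\<close> of the response. Since \<open>a\<close> exceeds \<open>n\<close> by
    \<open>d + 1\<close>, the opposite estimate reads \<open>(d + 1) * m \<le> \<beta>\<close>, and
    both together force \<open>m = 0\<close>.\<close>
  define d where "d = n ^ Suc \<kappa> / \<bar>g \<kappa> u\<bar>"
  have d: "d > 0" using n u by (simp add: d_def)
  define a where "a = n + d + 1"
  have a: "a > 0" using n d by (simp add: a_def)
  have main: "c k = 0"
    if L: "L > 0" and per: "\<And>k. c (k + L) = c k" "\<And>k q. q \<in> Y \<Longrightarrow> x (k + L) q = x k q"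
      and rec: "\<And>k q. q \<in> Y \<Longrightarrow> a * x (Suc k) q = push (x k) q + (if q = z then c k else 0)"
      and xU: "\<And>k u. u \<in> U \<Longrightarrow> x k u = 0"
    for L k and x :: "nat \<Rightarrow> 'y \<Rightarrow> real" and c :: "nat \<Rightarrow> real"
  proof -
    have per': "c (k + j * L) = c k \<and> (\<forall>q\<in>Y. x (k + j * L) q = x k q)" for k j
    proof (induction j)
      case (Suc j)
      then show ?case using per(1)[of "k + j * L"] per(2)[of _ "k + j * L"] by (simp add: algebra_simps)
    qed simp
    have modL: "c k = c (k mod L)" "q \<in> Y \<Longrightarrow> x k q = x (k mod L) q" for k q
      using per'[of "k mod L" "k div L"] by (auto simp: mod_div_mult_eq)
    \<comment> \<open>By periodicity one period contains all values, so both suprema are maxima of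
      finite sets.\<close>
    define \<beta> where "\<beta> = Max ((\<lambda>k. \<bar>c k\<bar>) ` {..<L})"
    define m where "m = Max ((\<lambda>(k, q). \<bar>x k q\<bar>) ` ({..<L} \<times> Y))"
    have \<beta>: "\<bar>c k\<bar> \<le> \<beta>" for k
      using L unfolding \<beta>_def modL(1)[of k] by (intro Max_ge) auto
    have m: "\<bar>x k q\<bar> \<le> m" if "q \<in> Y" for k q
      using L fin that unfolding m_def modL(2)[OF that, of k] by (intro Max_ge) auto
    have m0: "m \<ge> 0" using m[OF z, of 0] by linarith
    have "m \<in> (\<lambda>(k, q). \<bar>x k q\<bar>) ` ({..<L} \<times> Y)"
      unfolding m_def using L fin z by (intro Max_in) auto
    then obtain k0 q0 where kq: "q0 \<in> Y" "m = \<bar>x k0 q0\<bar>" by auto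
    \<comment> \<open>Moving on by one period gives the maximal entry a predecessor in time even
      when \<open>k0 = 0\<close>.\<close>
    have "k0 + L = Suc (k0 + L - 1)" using L by simp
    then have "a * x k0 q0 = push (x (k0 + L - 1)) q0 + (if q0 = z then c (k0 + L - 1) else 0)"
      using rec[OF kq(1), of "k0 + L - 1"] per(2)[OF kq(1), of k0] by simp
    moreover have "\<bar>push (x (k0 + L - 1)) q0\<bar> \<le> n * m"
      using m kq m0 by (intro push_le) auto
    moreover have "\<bar>if q0 = z then c (k0 + L - 1) else 0\<bar> \<le> \<beta>"
      using \<beta>[of "k0 + L - 1"] by auto
    moreover have "a * m = \<bar>a * x k0 q0\<bar>"
      using kq(2) a by (simp add: abs_mult)
    ultimately have "a * m \<le> n * m + \<beta>" by linarith
    then have am: "(d + 1) * m \<le> \<beta>" by (simp add: a_def algebra_simps)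
    \<comment> \<open>Pushing \<open>x k\<close> further \<open>j\<close> times gives the
      \<open>j\<close>-th output equation. On \<open>U\<close> the values \<open>y k j\<close>
      vanish up to \<open>j = \<kappa>\<close>, because the impulse response does so before
      \<open>\<kappa>\<close>; at \<open>u\<close> the next one therefore isolates
      \<open>c k * g \<kappa> u\<close>.\<close>
    define y where "y k j = (push ^^ j) (x k)" for k j
    have y_rec: "a * y (Suc k) j q = y k (Suc j) q + c k * g j q" if "q \<in> Y" for k j q
      using that
    proof (induction j arbitrary: q)
      case 0
      then show ?case using rec[OF 0, of k] by (simp add: y_def g_def)
    next
      case (Suc j)
      have "a * y (Suc k) (Suc j) q = (\<Sum>p\<in>Y. (a * y (Suc k) j p) * M p q)"
        by (simp add: y_def push_def sum_distrib_left mult.assoc)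
      also have "\<dots> = (\<Sum>p\<in>Y. (y k (Suc j) p + c k * g j p) * M p q)"
        using Suc.IH by (intro sum.cong) auto
      also have "\<dots> = (\<Sum>p\<in>Y. y k (Suc j) p * M p q) + c k * (\<Sum>p\<in>Y. g j p * M p q)"
        by (simp add: distrib_right sum.distrib sum_distrib_left mult.assoc)
      also have "\<dots> = y k (Suc (Suc j)) q + c k * g (Suc j) q"
        unfolding g_Suc by (simp add: y_def push_def)
      finally show ?case .
    qed
    have yU: "y k j u = 0" if "u \<in> U" "j \<le> \<kappa>" for k j u
      using that(2)
    proof (induction j arbitrary: k)
      case 0
      then show ?case using xU that by (simp add: y_def)
    next
      case (Suc j)
      then have "y (Suc k) j u = 0" "g j u = 0" using below that by auto
      then show ?case using y_rec[of u k j] that U by auto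
    qed
    have y_le: "\<bar>y k j q\<bar> \<le> n ^ j * m" if "q \<in> Y" for k j q
      using that
    proof (induction j arbitrary: q)
      case (Suc j)
      then have "\<bar>push (y k j) q\<bar> \<le> n * (n ^ j * m)"
        using n m0 by (intro push_le) auto
      then show ?case by (simp add: y_def mult.assoc)
    qed (use m in \<open>simp add: y_def\<close>)
    have "\<bar>c k\<bar> \<le> d * m" for k
    proof -
      have "y k (Suc \<kappa>) u + c k * g \<kappa> u = 0"
        using y_rec[of u k \<kappa>] yU[of u \<kappa>] u U by auto
      then have "\<bar>c k\<bar> * \<bar>g \<kappa> u\<bar> = \<bar>y k (Suc \<kappa>) u\<bar>" by (simp flip: abs_mult)
      also have "\<dots> \<le> n ^ Suc \<kappa> * m" using y_le u U by blast
      finally show ?thesis using u by (simp add: d_def field_simps)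
    qed
    then have "\<beta> \<le> d * m" unfolding \<beta>_def using L by (subst Max_le_iff) auto
    with am have "m = 0" using m0 by (simp add: algebra_simps)
    then show "c k = 0" using \<open>\<And>k. \<bar>c k\<bar> \<le> d * m\<close>[of k] by simp
  qed
  show thesis
  proof (rule that[OF a])
    show "c k = 0" if "L > 0" "\<And>k. c (k + L) = c k" "\<And>k q. q \<in> Y \<Longrightarrow> x (k + L) q = x k q"
      "\<And>k q. q \<in> Y \<Longrightarrow>
        a * x (Suc k) q = (\<Sum>p\<in>Y. x k p * M p q) + (if q = z then c k else 0)"
      "\<And>k u. u \<in> U \<Longrightarrow> x k u = 0"
      for L k and x :: "nat \<Rightarrow> 'y \<Rightarrow> real" and c :: "nat \<Rightarrow> real"
      using main[where L = L and k = k and x = x and c = c, unfolded push_def, OF that] .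
  qed
qed


text \<open>Row iterates run against the edges: the cycle evolves by itself and feeds
  \<open>Y\<close> only through \<open>z\<close>. One turn multiplies the cycle values by
  \<open>a ^ L\<close>, so on \<open>Y\<close> the difference \<open>v (k + L) - a ^ L * v k\<close>
  is unforced and hidden, hence zero. After division by \<open>a ^ k\<close> everything is periodic
  and the gain estimate kills the signal at \<open>c0\<close>. Then the whole cycle vanishes and
  \<open>Y\<close> is unforced.\<close>

lemma input_observable_add_cycle:
  fixes M :: "'y \<Rightarrow> 'y \<Rightarrow> real"
  assumes fin: "finite Y" "finite C" and U: "U \<subseteq> Y" and obs: "input_observable Y U M"
    and z: "z \<in> Y" and disj: "Y \<inter> C = {}"
    and C: "C = range (\<lambda>k. (f ^^ k) c0)" and L: "L > 0" "(f ^^ L) c0 = c0"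
  shows "\<exists>a. input_observable (Y \<union> C) U
    (\<lambda>p q. if p \<in> Y then if q \<in> Y then M p q else 0
      else (if q = f p then a else 0) + (if p = c0 \<and> q = z then 1 else 0))"
proof (rule large_gain_hides_no_periodic_signal[OF fin(1) U obs z])
  fix a :: real
  assume a: "a > 0"
    and gain: "\<And>L (x :: nat \<Rightarrow> 'y \<Rightarrow> real) (c :: nat \<Rightarrow> real) k. L > 0 \<Longrightarrow>
      (\<And>k. c (k + L) = c k) \<Longrightarrow> (\<And>k q. q \<in> Y \<Longrightarrow> x (k + L) q = x k q) \<Longrightarrow>
      (\<And>k q. q \<in> Y \<Longrightarrow>
        a * x (Suc k) q = (\<Sum>p\<in>Y. x k p * M p q) + (if q = z then c k else 0)) \<Longrightarrow>
      (\<And>k u. u \<in> U \<Longrightarrow> x k u = 0) \<Longrightarrow> c k = 0"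
  define M' where "M' = (\<lambda>p q. if p \<in> Y then if q \<in> Y then M p q else 0
      else (if q = f p then a else 0) + (if p = c0 \<and> q = z then 1 else 0))"
  have fC: "f p \<in> C" if "p \<in> C" for p
  proof -
    from that obtain k where "p = (f ^^ k) c0" unfolding C by blast
    then have "f p = (f ^^ Suc k) c0" by simp
    then show ?thesis unfolding C by blast
  qed
  have c0: "c0 \<in> C" unfolding C by (rule range_eqI[of _ _ 0]) simp
  have fL: "(f ^^ L) p = p" if "p \<in> C" for p
  proof -
    from that obtain k where k: "p = (f ^^ k) c0" unfolding C by blast
    have "(f ^^ L) ((f ^^ k) c0) = (f ^^ k) ((f ^^ L) c0)"
      by (metis add.commute comp_apply funpow_add)
    then show ?thesis using k L(2) by simp
  qed
  have inj: "p = p'" if "p \<in> C" "p' \<in> C" "f p = f p'" for p p'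
  proof -
    obtain l where l: "L = Suc l" using L(1) by (cases L) auto
    have "p = (f ^^ l) (f p)"
      using fL[OF that(1)] unfolding l by (simp add: funpow_swap1)
    also have "\<dots> = (f ^^ l) (f p')" using that(3) by (rule arg_cong)
    also have "\<dots> = p'"
      using fL[OF that(2)] unfolding l by (simp add: funpow_swap1)
    finally show ?thesis .
  qed
  have to_c0: "\<exists>i. (f ^^ i) p = c0" if "p \<in> C" for p
  proof -
    from that obtain k where k: "p = (f ^^ k) c0" unfolding C by blast
    have "(f ^^ (j * L)) c0 = c0" for j
      by (induction j) (simp_all add: funpow_add L(2))
    \<comment> \<open>From the \<open>k\<close>-th point of the cycle, \<open>k * L - k\<close>
      further steps complete \<open>k\<close> full turns.\<close>
    then have "(f ^^ (k * L - k + k)) c0 = c0" using L(1) by simp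
    then show ?thesis unfolding k by (metis comp_apply funpow_add)
  qed
  have "v 0 q = 0" if rec: "\<forall>k. \<forall>q\<in>Y \<union> C. v (Suc k) q = (\<Sum>p\<in>Y \<union> C. v k p * M' p q)"
    and vU: "\<forall>k. \<forall>u\<in>U. v k u = 0" and q: "q \<in> Y \<union> C" for v :: "nat \<Rightarrow> 'y \<Rightarrow> real" and q
  proof -
    have split: "(\<Sum>p\<in>Y \<union> C. w p) = (\<Sum>p\<in>Y. w p) + (\<Sum>p\<in>C. w p)" for w :: "'y \<Rightarrow> real"
      using fin disj by (rule sum.union_disjoint)
    have rec_C: "v (Suc k) (f p) = a * v k p" if p: "p \<in> C" for k p
    proof -
      have "v (Suc k) (f p) = (\<Sum>p'\<in>Y. v k p' * M' p' (f p)) + (\<Sum>p'\<in>C. v k p' * M' p' (f p))"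
        using rec fC[OF p] by (simp add: split)
      also have "(\<Sum>p'\<in>Y. v k p' * M' p' (f p)) = 0"
        using fC[OF p] disj by (intro sum.neutral) (auto simp: M'_def)
      also have "(\<Sum>p'\<in>C. v k p' * M' p' (f p)) = (\<Sum>p'\<in>C. if p' = p then a * v k p else 0)"
      proof (rule sum.cong[OF refl])
        fix p' assume p': "p' \<in> C"
        have "p' \<notin> Y" "f p \<noteq> z" "f p = f p' \<longleftrightarrow> p' = p"
          using p' disj z fC[OF p] inj[OF p p'] by auto
        then show "v k p' * M' p' (f p) = (if p' = p then a * v k p else 0)"
          by (simp add: M'_def)
      qed
      also have "\<dots> = a * v k p" using p fin by simp
      finally show ?thesis by simp
    qed
    have rec_Y: "v (Suc k) q = (\<Sum>p\<in>Y. v k p * M p q) + (if q = z then v k c0 else 0)"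
      if q: "q \<in> Y" for k q
    proof -
      have "(\<Sum>p\<in>C. v k p * M' p q) = (\<Sum>p\<in>C. if p = c0 then (if q = z then v k c0 else 0) else 0)"
      proof (rule sum.cong[OF refl])
        fix p assume p: "p \<in> C"
        have "p \<notin> Y" "q \<noteq> f p" using p fC[OF p] q disj by auto
        then show "v k p * M' p q = (if p = c0 then (if q = z then v k c0 else 0) else 0)"
          by (simp add: M'_def)
      qed
      also have "\<dots> = (if q = z then v k c0 else 0)" using c0 fin by simp
      finally show ?thesis using rec q by (simp add: split) (simp add: M'_def)
    qed
    have pow_C: "v (k + j) ((f ^^ j) p) = a ^ j * v k p" if "p \<in> C" for k j p
    proof (induction j)
      case (Suc j)
      have "(f ^^ j) p \<in> C" using that fC by (induction j) auto
      then show ?case using rec_C[of "(f ^^ j) p" "k + j"] Suc by simp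
    qed simp
    have per_C: "v (k + L) p = a ^ L * v k p" if "p \<in> C" for k p
      using pow_C[OF that, of k L] fL[OF that] by simp
    have per_Y: "v (k + L) q - a ^ L * v k q = 0" if "q \<in> Y" for k q
    proof (rule input_observableD[OF obs _ _ that, where v = "\<lambda>k q. v (k + L) q - a ^ L * v k q"])
      fix k q assume "q \<in> Y"
      then show "v (Suc k + L) q - a ^ L * v (Suc k) q =
          (\<Sum>p\<in>Y. (v (k + L) p - a ^ L * v k p) * M p q)"
        using rec_Y[of q k] rec_Y[of q "k + L"] per_C[OF c0, of k]
        by (simp add: left_diff_distrib sum_subtractf sum_distrib_left mult.assoc distrib_left)
    qed (use vU in simp)
    have "v k c0 / a ^ k = 0" for k
    proof (rule gain[OF L(1), where x = "\<lambda>k q. v k q / a ^ k" and c = "\<lambda>k. v k c0 / a ^ k"])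
      show "v (k + L) c0 / a ^ (k + L) = v k c0 / a ^ k" for k
        using per_C[OF c0, of k] a by (simp add: power_add)
      show "v (k + L) q / a ^ (k + L) = v k q / a ^ k" if "q \<in> Y" for k q
        using per_Y[OF that, of k] a by (simp add: power_add)
      show "a * (v (Suc k) q / a ^ Suc k) =
          (\<Sum>p\<in>Y. v k p / a ^ k * M p q) + (if q = z then v k c0 / a ^ k else 0)"
        if "q \<in> Y" for k q
      proof -
        have "(\<Sum>p\<in>Y. v k p / a ^ k * M p q) = (\<Sum>p\<in>Y. v k p * M p q) / a ^ k"
          by (simp add: sum_divide_distrib)
        then show ?thesis using rec_Y[OF that, of k] a by (simp flip: add_divide_distrib)
      qed
    qed (use vU in simp)
    then have v_c0: "v k c0 = 0" for k using a by simp
    have v_C: "v k p = 0" if "p \<in> C" for k p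
    proof -
      from to_c0[OF that] obtain i where "(f ^^ i) p = c0" ..
      with pow_C[OF that, of k i] v_c0 a show ?thesis by simp
    qed
    have v_Y: "v 0 q = 0" if "q \<in> Y" for q
    proof (rule input_observableD[of Y U M v, OF obs _ _ that])
      show "v (Suc k) q = (\<Sum>p\<in>Y. v k p * M p q)" if "q \<in> Y" for k q
        using rec_Y[OF that, of k] v_c0 by simp
    qed (use vU in simp)
    from q v_C v_Y show ?thesis by blast
  qed
  then show ?thesis
    unfolding input_observable_def M'_def by blast
qed

text \<open>
  Chains of \<open>f\<close> ending in \<open>U\<close> are observable by themselves; the remaining vertices lie on cycles
  of \<open>f\<close>, which are attached one after the other by a single entering edge each.
\<close>

lemma ex_input_observable:
  fixes E :: "'y \<Rightarrow> 'y \<Rightarrow> bool"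
  assumes fin: "finite Y" and U: "U \<subseteq> Y" and inj: "inj_on f (Y - U)"
    and f: "\<And>p. p \<in> Y - U \<Longrightarrow> f p \<in> Y \<and> E p (f p)"
    and acc: "\<And>Z. U \<subseteq> Z \<Longrightarrow> Z \<subseteq> Y \<Longrightarrow> (\<And>p q. q \<in> Z \<Longrightarrow> p \<in> Y - U \<Longrightarrow> E p q \<Longrightarrow> p \<in> Z) \<Longrightarrow> Z = Y"
  shows "\<exists>M. input_observable Y U M \<and> (\<forall>p\<in>Y - U. \<forall>q\<in>Y. M p q \<noteq> 0 \<longrightarrow> E p q)"
proof -
  \<comment> \<open>The equivalence for \<open>f\<close> says that no orbit enters or leaves
    \<open>Z\<close> outside \<open>U\<close>, so what remains is a union of whole cycles.\<close>
  have grow: "\<exists>M. input_observable Y U M \<and> (\<forall>p\<in>Y - U. \<forall>q\<in>Y. M p q \<noteq> 0 \<longrightarrow> E p q)"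
    if "U \<subseteq> Z" "Z \<subseteq> Y" "\<forall>p\<in>Y - U. f p \<in> Z \<longleftrightarrow> p \<in> Z" "input_observable Z U M"
      "\<forall>p\<in>Z - U. \<forall>q\<in>Z. M p q \<noteq> 0 \<longrightarrow> E p q" for Z M
    using that
  proof (induction "card (Y - Z)" arbitrary: Z M rule: less_induct)
    case less
    note UZ = less.prems(1) and ZY = less.prems(2) and closed = less.prems(3)
    show ?case
    proof (cases "Z = Y")
      case False
      \<comment> \<open>Accessibility rules out a proper \<open>Z\<close> closed under outgoing
        edges, which yields an edge from \<open>z\<close> in \<open>Z\<close> to a new vertex
        \<open>c0\<close>: the entering edge of the next cycle.\<close>
      with acc[OF UZ ZY] obtain c0 z where c0: "c0 \<in> Y - U" "c0 \<notin> Z" and z: "z \<in> Z" "E c0 z"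
        by blast
      define C where "C = range (\<lambda>k. (f ^^ k) c0)"
      have C: "C \<subseteq> Y - Z"
      proof -
        have "(f ^^ k) c0 \<in> Y - Z" for k
        proof (induction k)
          case (Suc k)
          then have "(f ^^ k) c0 \<in> Y - U" using UZ by auto
          then show ?case using f[of "(f ^^ k) c0"] closed Suc by auto
        qed (use c0 in simp)
        then show ?thesis by (auto simp: C_def)
      qed
      then have CU: "C \<subseteq> Y - U" using UZ by blast
      have fin_C: "finite C" using C fin finite_subset by blast
      have fC: "f ` C \<subseteq> C"
      proof
        fix y assume "y \<in> f ` C"
        then obtain k where "y = (f ^^ Suc k) c0" by (auto simp: C_def)
        then show "y \<in> C" unfolding C_def by blast
      qed
      have inj_C: "inj_on f C" using inj CU by (rule inj_on_subset)
      have C_in: "(f ^^ k) c0 \<in> C" for k by (auto simp: C_def)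
      \<comment> \<open>Finiteness only makes the orbit of \<open>c0\<close> eventually periodic;
        injectivity lets the repetition be traced back to \<open>c0\<close> itself.\<close>
      have cancel: "(f ^^ d) c0 = c0" if "(f ^^ (i + d)) c0 = (f ^^ i) c0" for i d
        using that
      proof (induction i)
        case (Suc i)
        then show ?case using inj_onD[OF inj_C _ C_in C_in] by simp
      qed simp
      have "\<not> inj (\<lambda>k. (f ^^ k) c0)"
        using fin_C unfolding C_def by (metis finite_imageD infinite_UNIV_nat)
      then obtain i j where "i < j" "(f ^^ i) c0 = (f ^^ j) c0"
        unfolding inj_def by (metis linorder_neqE_nat)
      then have L: "j - i > 0" "(f ^^ (j - i)) c0 = c0" using cancel[of i "j - i"] by auto
      have disj: "Z \<inter> C = {}" using C by blast
      from input_observable_add_cycle[OF finite_subset[OF ZY fin] fin_C UZ less.prems(4) z(1) disj C_def L]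
      obtain a where obs: "input_observable (Z \<union> C) U
          (\<lambda>p q. if p \<in> Z then if q \<in> Z then M p q else 0
            else (if q = f p then a else 0) + (if p = c0 \<and> q = z then 1 else 0))"
        ..
      show ?thesis
      proof (rule less.hyps[OF _ _ _ _ obs])
        have "c0 \<in> C" using C_in[of 0] by simp
        then show "card (Y - (Z \<union> C)) < card (Y - Z)"
          using fin c0 by (intro psubset_card_mono) auto
        show "\<forall>p\<in>Y - U. f p \<in> Z \<union> C \<longleftrightarrow> p \<in> Z \<union> C"
        proof
          fix p assume p: "p \<in> Y - U"
          \<comment> \<open>\<open>f\<close> permutes the finite set \<open>C\<close>, so by
            injectivity no vertex outside the cycle is mapped into it.\<close>
          have "p \<in> C" if "f p \<in> C"
          proof -
            have "f ` C = C" using fin_C fC inj_C by (rule endo_inj_surj)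
            with that obtain p' where "p' \<in> C" "f p = f p'" by (metis imageE)
            then show ?thesis using inj_onD[OF inj _ p, of p'] CU by auto
          qed
          then show "f p \<in> Z \<union> C \<longleftrightarrow> p \<in> Z \<union> C" using closed p fC by blast
        qed
        show "\<forall>p\<in>Z \<union> C - U. \<forall>q\<in>Z \<union> C. (if p \<in> Z then if q \<in> Z then M p q else 0
            else (if q = f p then a else 0) + (if p = c0 \<and> q = z then 1 else 0)) \<noteq> 0 \<longrightarrow> E p q"
          using less.prems(5) f CU z by (auto split: if_splits)
      qed (use UZ ZY C in auto)
    qed (use less.prems in auto)
  qed
  define Z where "Z = {p \<in> Y. \<exists>k. (f ^^ k) p \<in> U}"
  have UZ: "U \<subseteq> Z"
  proof
    fix u assume "u \<in> U"
    then show "u \<in> Z" using U by (auto simp: Z_def intro: exI[of _ 0])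
  qed
  have closed: "f p \<in> Z \<longleftrightarrow> p \<in> Z" if p: "p \<in> Y - U" for p
  proof
    assume "f p \<in> Z"
    then obtain k where "(f ^^ k) (f p) \<in> U" by (auto simp: Z_def)
    then have "(f ^^ Suc k) p \<in> U" by (simp add: funpow_swap1)
    then show "p \<in> Z" using p unfolding Z_def by blast
  next
    assume "p \<in> Z"
    then obtain k where k: "(f ^^ k) p \<in> U" by (auto simp: Z_def)
    with p obtain l where "k = Suc l" by (cases k) auto
    with k have "(f ^^ l) (f p) \<in> U" by (simp add: funpow_swap1)
    then show "f p \<in> Z" using f[OF p] by (auto simp: Z_def)
  qed
  define M where "M = (\<lambda>p q. if q = f p then 1 else 0 :: real)"
  have "input_observable Z U M"
    unfolding input_observable_def
  proof (intro allI impI ballI)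
    fix v :: "nat \<Rightarrow> 'y \<Rightarrow> real" and q
    assume rec: "\<forall>k. \<forall>q\<in>Z. v (Suc k) q = (\<Sum>p\<in>Z. v k p * M p q)"
      and vU: "\<forall>k. \<forall>u\<in>U. v k u = 0" and q: "q \<in> Z"
    have "v j p = 0" if "p \<in> Z" "(f ^^ k) p \<in> U" for j k p
      using that
    proof (induction k arbitrary: p j)
      case (Suc k)
      show ?case
      proof (cases "p \<in> U")
        case False
        then have p: "p \<in> Y - U" "f p \<in> Z" using Suc.prems closed by (auto simp: Z_def)
        have "0 = v (Suc j) (f p)" using Suc p by (simp add: funpow_swap1)
        also have "\<dots> = (\<Sum>p'\<in>Z. v j p' * M p' (f p))" using rec p by simp
        \<comment> \<open>Rows in \<open>U\<close> carry the value 0 and \<open>f\<close> is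
          injective elsewhere, so column \<open>f p\<close> reads off \<open>v j p\<close> alone.
          Zeros thus travel back along the chain from its end in \<open>U\<close>.\<close>
        also have "\<dots> = (\<Sum>p'\<in>Z. if p' = p then v j p else 0)"
          using inj_onD[OF inj _ p(1)] vU by (intro sum.cong refl) (auto simp: M_def Z_def)
        also have "\<dots> = v j p" using Suc.prems fin by (simp add: Z_def)
        finally show ?thesis by simp
      qed (use vU in simp)
    qed (use vU in simp)
    with q show "v 0 q = 0" by (auto simp: Z_def)
  qed
  then show ?thesis
    using UZ closed f by (intro grow[of Z M]) (auto simp: Z_def M_def split: if_splits)
qed

section \<open>Polynomial steering\<close>

text \<open>Divisibility by powers of \<open>t * (t - 1)\<close> expresses vanishing to a given
  order at both end times of the unit steering interval. The roots are simple, so the derivative is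
  invertible modulo this polynomial.\<close>

definition bump :: "real poly" where
  "bump = [:0, -1, 1:]"

lemma pderiv_bump_square: "pderiv bump * pderiv bump = 1 + smult 4 bump"
  by (simp add: bump_def pderiv_pCons one_pCons)

lemma smult_sum_right: "smult c (\<Sum>i\<in>I. f i) = (\<Sum>i\<in>I. smult c (f i))"
  by (induction I rule: infinite_finite_induct) (simp_all add: smult_add_right)

text \<open>
  A polynomial trajectory that responds to the forcing \<open>v h\<close> and vanishes at the times \<open>0\<close> and \<open>1\<close>,
  the roots of \<open>bump\<close>.
\<close>

definition absorbs :: "'x set \<Rightarrow> 'u set \<Rightarrow> ('x \<Rightarrow> 'x \<Rightarrow> real) \<Rightarrow> ('x \<Rightarrow> 'u \<Rightarrow> real) \<Rightarrow>
    ('x \<Rightarrow> real) \<Rightarrow> real poly \<Rightarrow> ('x \<Rightarrow> real poly) \<Rightarrow> ('u \<Rightarrow> real poly) \<Rightarrow> bool" where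
  "absorbs X U A B v h y u \<longleftrightarrow> (\<forall>p\<in>X. bump dvd y p \<and>
     pderiv (y p) = (\<Sum>q\<in>X. smult (A p q) (y q)) + (\<Sum>r\<in>U. smult (B p r) (u r)) + smult (v p) h)"

text \<open>\<open>N\<close> bounds how often the forcing has to be differentiated; vanishing to
  that order keeps every correction zero at both ends.\<close>

definition absorbable ::
  "'x set \<Rightarrow> 'u set \<Rightarrow> ('x \<Rightarrow> 'x \<Rightarrow> real) \<Rightarrow> ('x \<Rightarrow> 'u \<Rightarrow> real) \<Rightarrow> ('x \<Rightarrow> real) \<Rightarrow> nat \<Rightarrow> bool" where
  "absorbable X U A B v N \<longleftrightarrow> (\<forall>h. bump ^ N dvd h \<longrightarrow> (\<exists>y u. absorbs X U A B v h y u))"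

lemma absorbable_mono: "absorbable X U A B v N \<Longrightarrow> N \<le> N' \<Longrightarrow> absorbable X U A B v N'"
  unfolding absorbable_def by (meson dvd_trans le_imp_power_dvd)

lemma absorbable_add:
  assumes "absorbable X U A B v N" "absorbable X U A B w N"
  shows "absorbable X U A B (\<lambda>p. v p + w p) N"
  unfolding absorbable_def
proof (intro allI impI)
  fix h assume h: "bump ^ N dvd h"
  with assms obtain y u y' u' where "absorbs X U A B v h y u" "absorbs X U A B w h y' u'"
    unfolding absorbable_def by meson
  then have "absorbs X U A B (\<lambda>p. v p + w p) h (\<lambda>p. y p + y' p) (\<lambda>r. u r + u' r)"
    by (simp add: absorbs_def pderiv_add smult_add_right smult_add_left sum.distrib)
  then show "\<exists>y u. absorbs X U A B (\<lambda>p. v p + w p) h y u" by (intro exI)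
qed

lemma absorbable_scale:
  assumes "absorbable X U A B v N"
  shows "absorbable X U A B (\<lambda>p. c * v p) N"
  unfolding absorbable_def
proof (intro allI impI)
  fix h assume h: "bump ^ N dvd h"
  with assms obtain y u where "absorbs X U A B v h y u"
    unfolding absorbable_def by meson
  then have "absorbs X U A B (\<lambda>p. c * v p) h (\<lambda>p. smult c (y p)) (\<lambda>r. smult c (u r))"
    by (simp add: absorbs_def pderiv_smult smult_add_right smult_sum_right dvd_smult mult.commute)
  then show "\<exists>y u. absorbs X U A B (\<lambda>p. c * v p) h y u" by (intro exI)
qed

text \<open>The input cancels such a forcing directly while the state stays at zero, which is why
  the order is 0.\<close>

lemma absorbable_input:
  assumes "finite U" "r \<in> U"
  shows "absorbable X U A B (\<lambda>p. B p r) 0"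
  unfolding absorbable_def
proof (intro allI impI)
  fix h :: "real poly"
  have "(\<Sum>s\<in>U. smult (B p s) (if s = r then - h else 0)) = - smult (B p r) h" for p
  proof -
    have "(\<Sum>s\<in>U. smult (B p s) (if s = r then - h else 0)) = (\<Sum>s\<in>U. if s = r then - smult (B p r) h else 0)"
      by (intro sum.cong) auto
    then show ?thesis using assms by simp
  qed
  then have "absorbs X U A B (\<lambda>p. B p r) h (\<lambda>p. 0) (\<lambda>s. if s = r then - h else 0)"
    by (simp add: absorbs_def)
  then show "\<exists>y u. absorbs X U A B (\<lambda>p. B p r) h y u" by (intro exI)
qed

text \<open>The substitution \<open>y = w - v h\<close> trades the forcing \<open>A v h\<close> for \<open>v h'\<close>.\<close>

lemma absorbable_step:
  assumes "absorbable X U A B v N"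
  shows "absorbable X U A B (\<lambda>p. \<Sum>q\<in>X. A p q * v q) (Suc N)"
  unfolding absorbable_def
proof (intro allI impI)
  fix h :: "real poly" assume "bump ^ Suc N dvd h"
  then obtain g where g: "h = bump ^ Suc N * g" ..
  have h: "bump dvd h" unfolding g by simp
  have "pderiv h = bump ^ N * (smult (of_nat (Suc N)) (pderiv bump) * g + bump * pderiv g)"
    unfolding g pderiv_mult pderiv_power_Suc by (simp add: algebra_simps)
  then have "bump ^ N dvd pderiv h" by simp
  with assms obtain w u where "absorbs X U A B v (pderiv h) w u"
    unfolding absorbable_def by meson
  then have "absorbs X U A B (\<lambda>p. \<Sum>q\<in>X. A p q * v q) h (\<lambda>p. w p - smult (v p) h) u"
    using h by (simp add: absorbs_def dvd_diff dvd_smult pderiv_diff pderiv_smult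
        smult_diff_right sum_subtractf smult_sum)
  then show "\<exists>y u. absorbs X U A B (\<lambda>p. \<Sum>q\<in>X. A p q * v q) h y u" by (intro exI)
qed

text \<open>
  Newton steps modulo powers of \<open>bump\<close>: \<open>pderiv bump\<close> is its own inverse modulo \<open>bump\<close>.
\<close>

lemma ex_interpolation_flat_residual:
  fixes A :: "'x \<Rightarrow> 'x \<Rightarrow> real"
  shows "\<exists>z. \<forall>p\<in>X. poly (z p) 0 = x0 p \<and> poly (z p) 1 = x1 p \<and>
    bump ^ N dvd pderiv (z p) - (\<Sum>q\<in>X. smult (A p q) (z q))"
proof (induction N)
  case 0
  show ?case by (intro exI[of _ "\<lambda>p. [:x0 p, x1 p - x0 p:]"]) simp
next
  case (Suc N)
  then obtain z where z: "\<And>p. p \<in> X \<Longrightarrow> poly (z p) 0 = x0 p \<and> poly (z p) 1 = x1 p"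
    and "\<forall>p\<in>X. bump ^ N dvd pderiv (z p) - (\<Sum>q\<in>X. smult (A p q) (z q))"
    by blast
  then have "\<forall>p\<in>X. \<exists>r. pderiv (z p) - (\<Sum>q\<in>X. smult (A p q) (z q)) = bump ^ N * r"
    by (simp add: dvd_def)
  from bchoice[OF this] obtain r
    where r: "\<And>p. p \<in> X \<Longrightarrow> pderiv (z p) - (\<Sum>q\<in>X. smult (A p q) (z q)) = bump ^ N * r p"
    by blast
  \<comment> \<open>The correction \<open>bump ^ Suc N * w p\<close> leaves the end values alone and
    contributes \<open>Suc N * bump ^ N * pderiv bump * w p\<close> to the residual in leading
    order. This has to cancel \<open>bump ^ N * r p\<close>, and \<open>pderiv bump\<close> inverts
    itself up to a multiple of \<open>bump\<close>.\<close>
  define w where "w p = smult (- 1 / real (Suc N)) (pderiv bump * r p)" for p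
  have w: "smult (real (Suc N)) (pderiv bump * w p) = - r p - smult 4 (bump * r p)" for p
  proof -
    have "smult (real (Suc N)) (pderiv bump * w p) = - ((pderiv bump * pderiv bump) * r p)"
      by (simp add: w_def mult.assoc)
    then show ?thesis unfolding pderiv_bump_square by (simp add: algebra_simps)
  qed
  have residual: "pderiv (z p + bump ^ Suc N * w p) - (\<Sum>q\<in>X. smult (A p q) (z q + bump ^ Suc N * w q)) =
      bump ^ Suc N * (pderiv (w p) - smult 4 (r p) - (\<Sum>q\<in>X. smult (A p q) (w q)))"
    if p: "p \<in> X" for p
  proof -
    have "pderiv (z p + bump ^ Suc N * w p) - (\<Sum>q\<in>X. smult (A p q) (z q + bump ^ Suc N * w q)) =
        (pderiv (z p) - (\<Sum>q\<in>X. smult (A p q) (z q))) +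
        (bump ^ N * smult (real (Suc N)) (pderiv bump * w p) + bump ^ Suc N * pderiv (w p)) -
        bump ^ Suc N * (\<Sum>q\<in>X. smult (A p q) (w q))"
      unfolding pderiv_add pderiv_mult pderiv_power_Suc
      by (simp add: smult_add_right sum.distrib sum_distrib_left algebra_simps)
    also have "\<dots> = bump ^ Suc N * (pderiv (w p) - smult 4 (r p) - (\<Sum>q\<in>X. smult (A p q) (w q)))"
      unfolding r[OF p] w by (simp add: algebra_simps)
    finally show ?thesis .
  qed
  show ?case
  proof (intro exI[of _ "\<lambda>p. z p + bump ^ Suc N * w p"] ballI conjI)
    fix p assume p: "p \<in> X"
    show "bump ^ Suc N dvd
        pderiv (z p + bump ^ Suc N * w p) - (\<Sum>q\<in>X. smult (A p q) (z q + bump ^ Suc N * w q))"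
      unfolding residual[OF p] by (rule dvd_triv_left)
    have "poly bump 0 = 0" "poly bump 1 = 0" by (simp_all add: bump_def)
    then show "poly (z p + bump ^ Suc N * w p) 0 = x0 p" "poly (z p + bump ^ Suc N * w p) 1 = x1 p"
      using z[OF p] by simp_all
  qed
qed

text \<open>The absorbable directions form a subspace that contains the columns of \<open>B\<close>
  and is invariant under \<open>A\<close>. All left iterates of a row vector annihilating it
  annihilate it too, so they vanish at the inputs and observability makes the vector zero. Hence
  every unit vector is absorbable, and the residual of an interpolating curve is removed one
  coordinate at a time.\<close>

lemma controllable_if_input_observable:
  fixes M :: "'x + 'u \<Rightarrow> 'x + 'u \<Rightarrow> real"
  assumes fin: "finite X" "finite U" and obs: "input_observable (X <+> U) (Inr ` U) M"
  shows "controllable X U (\<lambda>p q. M (Inl p) (Inl q)) (\<lambda>p r. M (Inl p) (Inr r))"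
proof -
  define A where "A p q = M (Inl p) (Inl q)" for p q
  define B where "B p r = M (Inl p) (Inr r)" for p r
  define K where "K = {v. \<exists>N. absorbable X U A B v N}"
  have K_add: "(\<lambda>p. v p + w p) \<in> K" if "v \<in> K" "w \<in> K" for v w
  proof -
    from that obtain N N' where "absorbable X U A B v N" "absorbable X U A B w N'"
      unfolding K_def by blast
    then have "absorbable X U A B v (max N N')" "absorbable X U A B w (max N N')"
      by (meson absorbable_mono max.cobounded1 max.cobounded2)+
    from absorbable_add[OF this] show ?thesis unfolding K_def by blast
  qed
  have K_scale: "(\<lambda>p. c * v p) \<in> K" if "v \<in> K" for c v
    using that absorbable_scale unfolding K_def by blast
  have K_step: "(\<lambda>p. \<Sum>q\<in>X. A p q * v q) \<in> K" if "v \<in> K" for v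
    using that absorbable_step unfolding K_def by blast
  have K_input: "(\<lambda>p. B p r) \<in> K" if "r \<in> U" for r
    using absorbable_input[OF fin(2) that, of X A B] unfolding K_def by blast
  have K_ann: "\<forall>p\<in>X. w p = 0" if w: "\<forall>v\<in>K. (\<Sum>p\<in>X. w p * v p) = 0" for w
  proof -
    \<comment> \<open>Summing over \<open>X\<close> alone agrees with the sum over
      \<open>X <+> U\<close>, since the input components start at zero and stay zero.\<close>
    define v where "v = rec_nat (case_sum w (\<lambda>_. 0)) (\<lambda>_ f q. \<Sum>p\<in>X. f (Inl p) * M (Inl p) q)"
    have v0: "v 0 = case_sum w (\<lambda>_. 0)"
      and v_Suc: "v (Suc k) q = (\<Sum>p\<in>X. v k (Inl p) * M (Inl p) q)" for k q
      by (simp_all add: v_def)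
    have v_K: "(\<Sum>p\<in>X. v k (Inl p) * x p) = 0" if "x \<in> K" for k x
      using that
    proof (induction k arbitrary: x)
      case 0
      then show ?case using w by (simp add: v0)
    next
      case (Suc k)
      have "(\<Sum>q\<in>X. v (Suc k) (Inl q) * x q) = (\<Sum>q\<in>X. \<Sum>p\<in>X. v k (Inl p) * (A p q * x q))"
        by (simp add: v_Suc A_def sum_distrib_right mult.assoc)
      also have "\<dots> = (\<Sum>p\<in>X. v k (Inl p) * (\<Sum>q\<in>X. A p q * x q))"
        by (subst sum.swap) (simp add: sum_distrib_left)
      also have "\<dots> = 0" by (rule Suc.IH[OF K_step[OF Suc.prems]])
      finally show ?case .
    qed
    have v_U: "v k (Inr r) = 0" if "r \<in> U" for k r
    proof (cases k)
      case (Suc l)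
      then show ?thesis using v_K[OF K_input[OF that], of l] by (simp add: v_Suc B_def)
    qed (simp add: v0)
    have "v 0 (Inl p) = 0" if "p \<in> X" for p
    proof (rule input_observableD[of "X <+> U" "Inr ` U" M v, OF obs])
      show "v (Suc k) q = (\<Sum>p\<in>X <+> U. v k p * M p q)" for k q
        using fin v_U by (simp add: sum.Plus v_Suc)
    qed (use v_U that in auto)
    then show ?thesis by (simp add: v0)
  qed
  have "\<forall>p\<in>X. \<exists>N. \<exists>v. absorbable X U A B v N \<and> (\<forall>q\<in>X. v q = (if q = p then 1 else 0))"
  proof
    fix p assume "p \<in> X"
    from unit_vectors_in_annihilator_free_subspace[OF fin(1) K_add K_scale K_ann this]
    show "\<exists>N. \<exists>v. absorbable X U A B v N \<and> (\<forall>q\<in>X. v q = (if q = p then 1 else 0))"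
      unfolding K_def by blast
  qed
  from bchoice[OF this] obtain N
    where N: "\<forall>p\<in>X. \<exists>v. absorbable X U A B v (N p) \<and> (\<forall>q\<in>X. v q = (if q = p then 1 else 0))"
    by blast
  from bchoice[OF N] obtain e where e: "\<And>p. p \<in> X \<Longrightarrow> absorbable X U A B (e p) (N p)"
    "\<And>p q. p \<in> X \<Longrightarrow> q \<in> X \<Longrightarrow> e p q = (if q = p then 1 else 0)"
    by blast
  define m where "m = (\<Sum>p\<in>X. N p)"
  have e': "absorbable X U A B (e p) m" if "p \<in> X" for p
    using absorbable_mono[OF e(1)[OF that]] member_le_sum[OF that, of N] fin by (simp add: m_def)
  have "controllable X U A B"
    unfolding controllable_def
  proof (intro allI)
    fix x0 x1 :: "'x \<Rightarrow> real"
    obtain z where z: "\<And>p. p \<in> X \<Longrightarrow> poly (z p) 0 = x0 p \<and> poly (z p) 1 = x1 p"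
      and "\<forall>p\<in>X. bump ^ m dvd pderiv (z p) - (\<Sum>q\<in>X. smult (A p q) (z q))"
      using ex_interpolation_flat_residual[of X x0 x1 m A] by blast
    \<comment> \<open>The negated residual: the trajectories absorbing it, one coordinate each, turn
      \<open>z\<close> into a solution.\<close>
    define h where "h p = (\<Sum>q\<in>X. smult (A p q) (z q)) - pderiv (z p)" for p
    have h: "bump ^ m dvd h p" if "p \<in> X" for p
      using \<open>\<forall>p\<in>X. bump ^ m dvd _ p\<close> that unfolding h_def
      by (metis dvd_minus_iff minus_diff_eq)
    have "\<forall>s\<in>X. \<exists>yu. absorbs X U A B (e s) (h s) (fst yu) (snd yu)"
      using e' h unfolding absorbable_def by (simp add: split_paired_Ex)
    from bchoice[OF this] obtain yu
      where yu: "\<forall>s\<in>X. absorbs X U A B (e s) (h s) (fst (yu s)) (snd (yu s))" ..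
    define y where "y s = fst (yu s)" for s
    define u where "u s = snd (yu s)" for s
    have u: "bump dvd y s p \<and> pderiv (y s p) =
        (\<Sum>q\<in>X. smult (A p q) (y s q)) + (\<Sum>r\<in>U. smult (B p r) (u s r)) + smult (e s p) (h s)"
      if "s \<in> X" "p \<in> X" for s p
      using yu that unfolding absorbs_def y_def u_def by blast
    define x where "x p = z p + (\<Sum>s\<in>X. y s p)" for p
    define w where "w r = (\<Sum>s\<in>X. u s r)" for r
    have x_deriv: "pderiv (x p) = (\<Sum>q\<in>X. smult (A p q) (x q)) + (\<Sum>r\<in>U. smult (B p r) (w r))"
      if p: "p \<in> X" for p
    proof -
      have "(\<Sum>s\<in>X. smult (e s p) (h s)) = (\<Sum>s\<in>X. if s = p then h p else 0)"
        using e(2)[OF _ p] by (intro sum.cong) auto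
      then have "(\<Sum>s\<in>X. smult (e s p) (h s)) = h p" using p fin by simp
      moreover have "(\<Sum>s\<in>X. pderiv (y s p)) = (\<Sum>s\<in>X. (\<Sum>q\<in>X. smult (A p q) (y s q)) +
          (\<Sum>r\<in>U. smult (B p r) (u s r)) + smult (e s p) (h s))"
        using u p by (intro sum.cong) auto
      moreover have "(\<Sum>s\<in>X. \<Sum>q\<in>X. smult (A p q) (y s q)) = (\<Sum>q\<in>X. smult (A p q) (\<Sum>s\<in>X. y s q))"
        by (subst sum.swap) (simp add: smult_sum_right)
      moreover have "(\<Sum>s\<in>X. \<Sum>r\<in>U. smult (B p r) (u s r)) = (\<Sum>r\<in>U. smult (B p r) (w r))"
        by (subst sum.swap) (simp add: smult_sum_right w_def)
      ultimately have "(\<Sum>s\<in>X. pderiv (y s p)) = (\<Sum>q\<in>X. smult (A p q) (\<Sum>s\<in>X. y s q)) +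
          (\<Sum>r\<in>U. smult (B p r) (w r)) + h p"
        by (simp add: sum.distrib)
      then show ?thesis
        by (simp add: x_def h_def pderiv_add higher_pderiv_sum[of 1, simplified] smult_add_right sum.distrib)
    qed
    have x_ends: "poly (x p) t = poly (z p) t" if p: "p \<in> X" and t: "t = 0 \<or> t = 1" for p t
    proof -
      have "poly (y s p) t = 0" if "s \<in> X" for s
      proof -
        from u[OF that p] obtain g where "y s p = bump * g" by (auto simp: dvd_def)
        then show ?thesis using t by (auto simp: bump_def)
      qed
      then show ?thesis by (simp add: x_def poly_sum)
    qed
    show "\<exists>T>0. \<exists>(x :: real \<Rightarrow> 'x \<Rightarrow> real) (u :: real \<Rightarrow> 'u \<Rightarrow> real).
       (\<forall>r\<in>U. continuous_on {0..T} (\<lambda>t. u t r)) \<and>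
       (\<forall>p\<in>X. \<forall>t\<in>{0..T}.
          ((\<lambda>s. x s p) has_real_derivative
             (\<Sum>q\<in>X. A p q * x t q) + (\<Sum>r\<in>U. B p r * u t r)) (at t within {0..T})) \<and>
       (\<forall>p\<in>X. x 0 p = x0 p \<and> x T p = x1 p)"
    proof (intro exI[of _ 1] conjI exI[of _ "\<lambda>t p. poly (x p) t"] exI[of _ "\<lambda>t r. poly (w r) t"] ballI)
      fix p t assume p: "p \<in> X"
      have "((\<lambda>s. poly (x p) s) has_real_derivative poly (pderiv (x p)) t) (at t within {0..1})"
        by (rule has_field_derivative_at_within[OF poly_DERIV])
      then show "((\<lambda>s. poly (x p) s) has_real_derivative
          (\<Sum>q\<in>X. A p q * poly (x q) t) + (\<Sum>r\<in>U. B p r * poly (w r) t)) (at t within {0..1})"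
        by (simp add: x_deriv[OF p] poly_sum)
    qed (use x_ends z in \<open>auto intro!: continuous_intros\<close>)
  qed
  then show ?thesis unfolding A_def[abs_def] B_def[abs_def] .
qed


section \<open>Lin's theorem\<close>

text \<open>Reachability from the inputs as an induction principle: it is used by exhibiting a
  closed set \<open>Z\<close> and proved by filling an arbitrary one, without handling paths in the
  composite digraph.\<close>

definition all_accessible ::
  "'x set \<Rightarrow> 'u set \<Rightarrow> ('x \<Rightarrow> 'x \<Rightarrow> bool) \<Rightarrow> ('x \<Rightarrow> 'u \<Rightarrow> bool) \<Rightarrow> bool" where
  "all_accessible X U PA PB \<longleftrightarrow> (\<forall>Z\<subseteq>X. (\<forall>p\<in>X. \<forall>r\<in>U. PB p r \<longrightarrow> p \<in> Z) \<longrightarrow>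
     (\<forall>q\<in>Z. \<forall>p\<in>X. PA p q \<longrightarrow> p \<in> Z) \<longrightarrow> Z = X)"

definition state_matching ::
  "'x set \<Rightarrow> 'u set \<Rightarrow> ('x \<Rightarrow> 'x \<Rightarrow> bool) \<Rightarrow> ('x \<Rightarrow> 'u \<Rightarrow> bool) \<Rightarrow> ('x \<Rightarrow> 'x + 'u) \<Rightarrow> bool" where
  "state_matching X U PA PB f \<longleftrightarrow> inj_on f X \<and>
     (\<forall>p\<in>X. case f p of Inl q \<Rightarrow> q \<in> X \<and> PA p q | Inr r \<Rightarrow> r \<in> U \<and> PB p r)"

text \<open>A Gronwall estimate: the energy \<open>g\<close> of the inaccessible states satisfies
  \<open>g' \<le> K * g\<close>, so \<open>exp (- K * t) * g t\<close> does not increase. Started at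
  zero these states stay at zero and cannot reach the value 1.\<close>

lemma controllable_imp_all_accessible:
  assumes fin: "finite X" and real: "numerical_realization X U PA PB A B"
    and ctrl: "controllable X U A B"
  shows "all_accessible X U PA PB"
  unfolding all_accessible_def
proof (intro allI impI)
  fix Z assume ZX: "Z \<subseteq> X" and ZB: "\<forall>p\<in>X. \<forall>r\<in>U. PB p r \<longrightarrow> p \<in> Z"
    and ZA: "\<forall>q\<in>Z. \<forall>p\<in>X. PA p q \<longrightarrow> p \<in> Z"
  define N where "N = X - Z"
  have finN: "finite N" using fin by (simp add: N_def)
  have "N = {}"
  proof (rule ccontr)
    assume "N \<noteq> {}"
    from ctrl[unfolded controllable_def, rule_format, of "\<lambda>_. 0" "\<lambda>_. 1"]
    obtain T and x :: "real \<Rightarrow> 'a \<Rightarrow> real" and u :: "real \<Rightarrow> 'b \<Rightarrow> real" where T: "T > 0"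
      and ode: "\<forall>p\<in>X. \<forall>t\<in>{0..T}. ((\<lambda>s. x s p) has_real_derivative
             (\<Sum>q\<in>X. A p q * x t q) + (\<Sum>r\<in>U. B p r * u t r)) (at t within {0..T})"
      and ends: "\<forall>p\<in>X. x 0 p = 0 \<and> x T p = 1"
      by blast
    have odeN: "((\<lambda>s. x s p) has_real_derivative (\<Sum>q\<in>N. A p q * x t q)) (at t within {0..T})"
      if p: "p \<in> N" and t: "t \<in> {0..T}" for p t
    proof -
      have "(\<Sum>r\<in>U. B p r * u t r) = 0"
        using real ZB p by (intro sum.neutral) (auto simp: numerical_realization_def N_def)
      moreover have "A p q = 0" if "q \<in> Z" for q
        using real ZA ZX p that unfolding numerical_realization_def N_def by blast
      then have "(\<Sum>q\<in>X. A p q * x t q) = (\<Sum>q\<in>N. A p q * x t q)"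
        using fin by (intro sum.mono_neutral_right) (auto simp: N_def)
      moreover have "p \<in> X" using p by (simp add: N_def)
      ultimately show ?thesis using ode[rule_format, of p t] t by simp
    qed
    define g where "g t = (\<Sum>p\<in>N. (x t p)\<^sup>2)" for t
    define g' where "g' t = (\<Sum>p\<in>N. 2 * x t p * (\<Sum>q\<in>N. A p q * x t q))" for t
    \<comment> \<open>Each product of two absolute values \<open>\<bar>x t p\<bar>\<close> and
      \<open>\<bar>x t q\<bar>\<close> is at most \<open>g t\<close>, because twice the product is
      bounded by the sum of the squares.\<close>
    define K where "K = (\<Sum>p\<in>N. \<Sum>q\<in>N. 2 * \<bar>A p q\<bar>)"
    have g_le: "(x t p)\<^sup>2 \<le> g t" if "p \<in> N" for p t
      unfolding g_def using finN that by (intro member_le_sum) auto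
    have g'_le: "g' t \<le> K * g t" for t
    proof -
      have "2 * (x t p * (A p q * x t q)) \<le> 2 * \<bar>A p q\<bar> * g t" if "p \<in> N" "q \<in> N" for p q
      proof -
        have "2 * (\<bar>x t p\<bar> * \<bar>x t q\<bar>) \<le> (x t p)\<^sup>2 + (x t q)\<^sup>2"
          using sum_squares_bound[of "\<bar>x t p\<bar>" "\<bar>x t q\<bar>"] by simp
        then have *: "\<bar>x t p\<bar> * \<bar>x t q\<bar> \<le> g t" using g_le[OF that(1), of t] g_le[OF that(2), of t] by simp
        have "x t p * (A p q * x t q) \<le> \<bar>A p q\<bar> * (\<bar>x t p\<bar> * \<bar>x t q\<bar>)"
          by (metis abs_ge_self abs_mult mult.left_commute)
        also have "\<dots> \<le> \<bar>A p q\<bar> * g t" using * by (intro mult_left_mono) auto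
        finally show ?thesis by simp
      qed
      then have "(\<Sum>p\<in>N. \<Sum>q\<in>N. 2 * (x t p * (A p q * x t q))) \<le> (\<Sum>p\<in>N. \<Sum>q\<in>N. 2 * \<bar>A p q\<bar> * g t)"
        by (intro sum_mono) auto
      then show ?thesis
        by (simp add: g'_def K_def sum_distrib_left sum_distrib_right mult.assoc)
    qed
    have deriv: "((\<lambda>s. exp (- K * s) * g s) has_real_derivative exp (- K * t) * (g' t - K * g t))
        (at t within {0..T})" if "t \<in> {0..T}" for t
      unfolding g_def g'_def using that
      by (auto intro!: derivative_eq_intros odeN simp: algebra_simps)
    have "exp (- K * T) * g T \<le> exp (- K * 0) * g 0"
    proof (rule DERIV_nonpos_imp_decreasing_open[OF less_imp_le[OF T]])
      fix t assume t: "0 < t" "t < T"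
      then have "((\<lambda>s. exp (- K * s) * g s) has_real_derivative exp (- K * t) * (g' t - K * g t)) (at t)"
        using deriv[of t] by (simp add: at_within_Icc_at)
      moreover have "exp (- K * t) * (g' t - K * g t) \<le> 0"
        using g'_le[of t] by (intro mult_nonneg_nonpos) auto
      ultimately show "\<exists>y. ((\<lambda>s. exp (- K * s) * g s) has_real_derivative y) (at t) \<and> y \<le> 0" by blast
    qed (rule DERIV_continuous_on[OF deriv])
    moreover have "g 0 = 0" "g T = real (card N)"
      using ends by (simp_all add: g_def N_def)
    moreover have "card N > 0" using \<open>N \<noteq> {}\<close> finN by (simp add: card_gt_0_iff)
    ultimately show False by (simp add: mult_le_0_iff)
  qed
  then show "Z = X" using ZX by (auto simp: N_def)
qed

text \<open>For \<open>v\<close> in the left kernel of \<open>[A B]\<close> the product of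
  \<open>v\<close> with the state is conserved. Steering from 0 to \<open>v\<close> itself turns
  this into a vanishing sum of squares, so the rows are independent.\<close>

lemma controllable_imp_state_matching:
  assumes fin: "finite X" "finite U" and real: "numerical_realization X U PA PB A B"
    and ctrl: "controllable X U A B"
  shows "\<exists>f. state_matching X U PA PB f"
proof -
  define W where "W p = case_sum (A p) (B p)" for p
  have "\<exists>f. inj_on f X \<and> (\<forall>p\<in>X. f p \<in> X <+> U \<and> W p (f p) \<noteq> 0)"
  proof (rule independent_rows_matching)
    fix v assume v: "\<forall>y\<in>X <+> U. (\<Sum>p\<in>X. v p * W p y) = 0"
    have vA: "(\<Sum>p\<in>X. v p * A p q) = 0" if "q \<in> X" for q
      using v[rule_format, of "Inl q"] that by (auto simp: W_def)
    have vB: "(\<Sum>p\<in>X. v p * B p r) = 0" if "r \<in> U" for r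
      using v[rule_format, of "Inr r"] that by (auto simp: W_def)
    from ctrl[unfolded controllable_def, rule_format, of "\<lambda>_. 0" v]
    obtain T and x :: "real \<Rightarrow> 'a \<Rightarrow> real" and u :: "real \<Rightarrow> 'b \<Rightarrow> real" where T: "T > 0"
      and ode: "\<forall>p\<in>X. \<forall>t\<in>{0..T}. ((\<lambda>s. x s p) has_real_derivative
             (\<Sum>q\<in>X. A p q * x t q) + (\<Sum>r\<in>U. B p r * u t r)) (at t within {0..T})"
      and ends: "\<forall>p\<in>X. x 0 p = 0 \<and> x T p = v p"
      by blast
    have deriv: "((\<lambda>s. \<Sum>p\<in>X. v p * x s p) has_real_derivative 0) (at t within {0..T})"
      if t: "t \<in> {0..T}" for t
    proof -
      have "((\<lambda>s. \<Sum>p\<in>X. v p * x s p) has_real_derivative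
          (\<Sum>p\<in>X. v p * ((\<Sum>q\<in>X. A p q * x t q) + (\<Sum>r\<in>U. B p r * u t r)))) (at t within {0..T})"
        using ode t by (intro DERIV_sum DERIV_cmult) auto
      also have "(\<Sum>p\<in>X. v p * ((\<Sum>q\<in>X. A p q * x t q) + (\<Sum>r\<in>U. B p r * u t r))) =
          (\<Sum>p\<in>X. \<Sum>q\<in>X. v p * A p q * x t q) + (\<Sum>p\<in>X. \<Sum>r\<in>U. v p * B p r * u t r)"
        by (simp add: distrib_left sum.distrib sum_distrib_left mult.assoc)
      also have "(\<Sum>p\<in>X. \<Sum>q\<in>X. v p * A p q * x t q) = (\<Sum>q\<in>X. (\<Sum>p\<in>X. v p * A p q) * x t q)"
        by (subst sum.swap) (simp add: sum_distrib_right)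
      also have "\<dots> = 0" using vA by simp
      also have "(\<Sum>p\<in>X. \<Sum>r\<in>U. v p * B p r * u t r) = (\<Sum>r\<in>U. (\<Sum>p\<in>X. v p * B p r) * u t r)"
        by (subst sum.swap) (simp add: sum_distrib_right)
      also have "\<dots> = 0" using vB by simp
      finally show ?thesis by simp
    qed
    have "(\<Sum>p\<in>X. v p * x T p) = (\<Sum>p\<in>X. v p * x 0 p)"
    proof (rule DERIV_isconst_end[OF T])
      show "((\<lambda>s. \<Sum>p\<in>X. v p * x s p) has_real_derivative 0) (at t)" if "0 < t" "t < T" for t
        using deriv[of t] that by (simp add: at_within_Icc_at)
    qed (rule DERIV_continuous_on[OF deriv])
    then have "(\<Sum>p\<in>X. v p * v p) = 0" using ends by simp
    then show "\<forall>p\<in>X. v p = 0" using fin by (simp add: sum_nonneg_eq_0_iff)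
  qed (use fin in auto)
  then obtain f where f: "inj_on f X" "\<forall>p\<in>X. f p \<in> X <+> U \<and> W p (f p) \<noteq> 0" by blast
  have "case f p of Inl q \<Rightarrow> q \<in> X \<and> PA p q | Inr r \<Rightarrow> r \<in> U \<and> PB p r" if "p \<in> X" for p
    using f(2)[rule_format, OF that] real that
    by (cases "f p") (auto simp: W_def numerical_realization_def)
  with f(1) show ?thesis unfolding state_matching_def by blast
qed

theorem structurally_controllable_iff:
  fixes X :: "'x set" and U :: "'u set"
  assumes fin: "finite X" "finite U"
  shows "structurally_controllable X U PA PB \<longleftrightarrow>
    all_accessible X U PA PB \<and> (\<exists>f. state_matching X U PA PB f)"
proof
  assume "structurally_controllable X U PA PB"
  then show "all_accessible X U PA PB \<and> (\<exists>f. state_matching X U PA PB f)"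
    unfolding structurally_controllable_def
    using controllable_imp_all_accessible[OF fin(1)] controllable_imp_state_matching[OF fin] by blast
next
  assume asm: "all_accessible X U PA PB \<and> (\<exists>f. state_matching X U PA PB f)"
  then obtain f where f: "state_matching X U PA PB f" by blast
  \<comment> \<open>Inputs become vertices that nothing drives, hence their empty rows;
    \<open>f'\<close> fixes them and is the given matching on the states.\<close>
  define E where "E y q = (case y of Inl p \<Rightarrow> case_sum (PA p) (PB p) q | Inr _ \<Rightarrow> False)"
    for y q :: "'x + 'u"
  define f' where "f' y = (case y of Inl p \<Rightarrow> f p | Inr r \<Rightarrow> Inr r)" for y :: "'x + 'u"
  have diff: "(X <+> U) - Inr ` U = Inl ` X" by auto
  have "\<exists>M. input_observable (X <+> U) (Inr ` U) M \<and>
      (\<forall>p\<in>(X <+> U) - Inr ` U. \<forall>q\<in>X <+> U. M p q \<noteq> 0 \<longrightarrow> E p q)"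
  proof (rule ex_input_observable[where f = f'])
    show "inj_on f' ((X <+> U) - Inr ` U)"
      using f unfolding diff by (auto simp: state_matching_def inj_on_def f'_def)
    show "f' p \<in> X <+> U \<and> E p (f' p)" if p: "p \<in> (X <+> U) - Inr ` U" for p
    proof -
      obtain p' where p': "p = Inl p'" "p' \<in> X" using p unfolding diff by blast
      with f show ?thesis
        by (cases "f p'") (force simp: state_matching_def f'_def E_def)+
    qed
  next
    fix Z assume UZ: "Inr ` U \<subseteq> Z" and ZY: "Z \<subseteq> X <+> U"
      and Z: "\<And>p q. q \<in> Z \<Longrightarrow> p \<in> (X <+> U) - Inr ` U \<Longrightarrow> E p q \<Longrightarrow> p \<in> Z"
    have "{p \<in> X. Inl p \<in> Z} = X"
    proof (rule asm[THEN conjunct1, unfolded all_accessible_def, rule_format])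
      show "p \<in> {p \<in> X. Inl p \<in> Z}" if "p \<in> X" "r \<in> U" "PB p r" for p r
        using Z[of "Inr r" "Inl p"] UZ that by (auto simp: E_def)
      show "p \<in> {p \<in> X. Inl p \<in> Z}" if "q \<in> {p \<in> X. Inl p \<in> Z}" "p \<in> X" "PA p q" for p q
        using Z[of "Inl q" "Inl p"] that by (auto simp: E_def)
    qed auto
    then show "Z = X <+> U" using UZ ZY by auto
  qed (use fin in auto)
  then obtain M where M: "input_observable (X <+> U) (Inr ` U) M"
    and E: "\<And>p q. p \<in> X \<Longrightarrow> q \<in> X <+> U \<Longrightarrow> M (Inl p) q \<noteq> 0 \<Longrightarrow> E (Inl p) q"
    unfolding diff by blast
  have "numerical_realization X U PA PB (\<lambda>p q. M (Inl p) (Inl q)) (\<lambda>p r. M (Inl p) (Inr r))"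
    using E[of _ "Inl _"] E[of _ "Inr _"] unfolding numerical_realization_def E_def by fastforce
  with controllable_if_input_observable[OF fin M]
  show "structurally_controllable X U PA PB"
    unfolding structurally_controllable_def by blast
qed

section \<open>Spanning trees\<close>

text \<open>A shortest-path tree: the parent of each vertex is strictly closer to \<open>r\<close>,
  so following parents ends there. Confining the tree to \<open>E\<close> serves the lower bound,
  where \<open>E\<close> admits only those weighted edges that a given solution pays for.\<close>

lemma ex_directed_spanning_tree:
  assumes "E \<subseteq> parcs G" and "E \<subseteq> pverts G \<times> pverts G" and r: "r \<in> pverts G"
    and reach: "\<And>v. v \<in> pverts G \<Longrightarrow> (r, v) \<in> E\<^sup>*"
  shows "\<exists>T\<subseteq>E. directed_spanning_tree G r T"
proof -
  define d where "d v = (LEAST n. (r, v) \<in> E ^^ n)" for v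
  have d: "(r, v) \<in> E ^^ d v" if v: "v \<in> pverts G" for v
    using reach[OF v] unfolding d_def by (metis LeastI rtrancl_imp_relpow)
  have "\<exists>u. (u, v) \<in> E \<and> d u < d v" if v: "v \<in> pverts G - {r}" for v
  proof -
    from d[of v] v obtain n where n: "d v = Suc n" by (cases "d v") auto
    with d[of v] v obtain u where "(r, u) \<in> E ^^ n" "(u, v) \<in> E" by auto
    then show ?thesis unfolding n by (auto simp: d_def Least_le le_imp_less_Suc)
  qed
  then obtain par where par: "\<And>v. v \<in> pverts G - {r} \<Longrightarrow> (par v, v) \<in> E \<and> d (par v) < d v"
    by metis
  define T where "T = (\<lambda>v. (par v, v)) ` (pverts G - {r})"
  define H where "H = with_proj \<lparr>pverts = pverts G, parcs = T\<rparr>"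
  have TE: "T \<subseteq> E" using par by (auto simp: T_def)
  have "in_arcs H r = {}" by (auto simp: H_def T_def)
  then have "in_degree H r = 0" by (simp add: in_degree_def)
  moreover have "in_degree H v = 1" if "v \<in> pverts G - {r}" for v
  proof -
    have "in_arcs H v = {(par v, v)}" using that by (auto simp: H_def T_def)
    then show ?thesis by (simp add: in_degree_def)
  qed
  moreover have "r \<rightarrow>\<^sup>*\<^bsub>H\<^esub> v" if "v \<in> pverts G" for v
    using that
  proof (induction "d v" arbitrary: v rule: less_induct)
    case less
    show ?case
    proof (cases "v = r")
      case True
      then show ?thesis using r by (simp add: reachable_def H_def)
    next
      case False
      then have v: "v \<in> pverts G - {r}" using less.prems by simp
      then have "par v \<in> pverts G" using par assms(2) by blast
      with less.hyps par[OF v] have "(r, par v) \<in> rtrancl_on (verts H) (arcs_ends H)"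
        unfolding reachable_def by blast
      moreover have "(par v, v) \<in> arcs_ends H" using v by (simp add: H_def T_def)
      ultimately show ?thesis
        using less.prems unfolding reachable_def
        by (auto intro: rtrancl_on_into_rtrancl_on simp: H_def)
    qed
  qed
  ultimately have "directed_spanning_tree G r T"
    using TE assms(1) by (auto simp: directed_spanning_tree_def H_def[symmetric] Let_def) (auto simp: H_def)
  with TE show ?thesis by blast
qed

section \<open>Composite systems\<close>

lemma finite_states: "finite (states S)"
proof -
  have "states S = Sigma {..<nsys S} (\<lambda>i. {..<sdim S i})" by (auto simp: states_def)
  then show ?thesis by simp
qed

lemma finite_inputs: "finite (inputs S)"
proof -
  have "inputs S = Sigma {..<nsys S} (\<lambda>i. {..<idim S i})" by (auto simp: inputs_def)
  then show ?thesis by simp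
qed

lemma permitted_subset: "permitted S \<subseteq> states S \<times> states S"
  by (auto simp: permitted_def)

lemma finite_permitted: "finite (permitted S)"
  by (rule finite_subset[OF permitted_subset]) (simp add: finite_states)

lemma feasible_iff:
  "feasible S F \<longleftrightarrow> F \<subseteq> permitted S \<and>
     all_accessible (states S) (inputs S) (composite_A S F) (composite_B S) \<and>
     (\<exists>f. state_matching (states S) (inputs S) (composite_A S F) (composite_B S) f)"
  by (simp add: feasible_def structurally_controllable_iff finite_states finite_inputs)

lemma min_interconnections_attained:
  assumes "feasible S F"
  shows "\<exists>F'. feasible S F' \<and> card F' = min_interconnections S"
proof -
  have "finite {F. feasible S F}"
    by (rule finite_subset[of _ "Pow (permitted S)"]) (auto simp: feasible_def finite_permitted)
  then have "min_interconnections S \<in> card ` {F. feasible S F}"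
    unfolding min_interconnections_def using assms by (intro Min_in) auto
  then show ?thesis by auto
qed

section \<open>Matchings\<close>

lemma bip_nbr_permitted: "(x, Inl y) \<in> bip_nbr S \<longleftrightarrow> (y, x) \<in> permitted S"
  by (cases x; cases y) (auto simp: bip_nbr_def permitted_def)

lemma matching_interconnections_permitted: "matching_interconnections S M \<subseteq> permitted S"
  by (auto simp: matching_interconnections_def bip_nbr_permitted)

text \<open>The image form is meant for counting; \<open>projl\<close> is harmless because edges in
  \<open>bip_nbr S\<close> never end in an input.\<close>

lemma matching_interconnections_eq:
  "matching_interconnections S M = (\<lambda>(x, y). (projl y, x)) ` (M \<inter> bip_nbr S)"
  by (force simp: matching_interconnections_def bip_nbr_def)

lemma matching_weight_eq_card:
  assumes "finite M"
  shows "matching_weight S M = card (M \<inter> bip_nbr S)"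
  using assms by (simp add: matching_weight_def flip: sum.inter_restrict)

lemma finite_perfect_matching: "perfect_matching S M \<Longrightarrow> finite M"
  by (metis finite_imageD finite_states perfect_matching_def)

lemma card_matching_interconnections:
  assumes "perfect_matching S M"
  shows "card (matching_interconnections S M) \<le> matching_weight S M"
  using finite_perfect_matching[OF assms]
  by (simp add: matching_interconnections_eq matching_weight_eq_card card_image_le)

text \<open>Lower bound for the first stage: a matching edge between different subsystems uses an
  interconnection of \<open>F\<close>, and different edges use different ones because each state
  occurs once on the left.\<close>

lemma state_matching_imp_perfect_matching:
  assumes F: "F \<subseteq> permitted S"
    and f: "state_matching (states S) (inputs S) (composite_A S F) (composite_B S) f"
  shows "\<exists>M. perfect_matching S M \<and> matching_weight S M \<le> card F"
proof -
  define M where "M = (\<lambda>p. (p, f p)) ` states S"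
  have fp: "(p, f p) \<in> bip_local S \<or> (\<exists>q. f p = Inl q \<and> (q, p) \<in> F)" if "p \<in> states S" for p
  proof -
    obtain i p' where p: "p = (i, p')" by (cases p)
    show ?thesis
    proof (cases "f p")
      case (Inl q)
      with f that have "q \<in> states S" "composite_A S F p q"
        by (auto simp: state_matching_def dest!: bspec[OF _ that])
      then show ?thesis using that Inl p
        by (cases q) (auto simp: bip_local_def split: if_splits)
    next
      case (Inr r)
      with f that have "r \<in> inputs S" "composite_B S p r"
        by (auto simp: state_matching_def dest!: bspec[OF _ that])
      then show ?thesis using that Inr p
        by (cases r) (auto simp: bip_local_def)
    qed
  qed
  have nbr: "\<exists>q. f p = Inl q \<and> (q, p) \<in> F" if "p \<in> states S" "(p, f p) \<in> bip_nbr S" for p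
    using fp[OF that(1)] that(2) by (auto simp: bip_local_def bip_nbr_def)
  have "perfect_matching S M"
    unfolding perfect_matching_def
  proof (intro conjI)
    show "M \<subseteq> bip_local S \<union> bip_nbr S"
      using fp F by (fastforce simp: M_def bip_nbr_permitted)
    show "inj_on snd M" using f by (auto simp: M_def state_matching_def inj_on_def)
    show "inj_on fst M" by (auto simp: M_def inj_on_def)
    show "fst ` M = states S" by (force simp: M_def)
  qed
  moreover have "(\<lambda>(x, y). (projl y, x)) ` (M \<inter> bip_nbr S) \<subseteq> F"
    using nbr by (fastforce simp: M_def)
  moreover have "inj_on (\<lambda>(x, y). (projl y, x)) (M \<inter> bip_nbr S)"
    by (auto simp: M_def inj_on_def)
  ultimately have "card (M \<inter> bip_nbr S) \<le> card F"
    using finite_subset[OF F finite_permitted] card_inj_on_le by blast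
  with \<open>perfect_matching S M\<close> show ?thesis
    using matching_weight_eq_card finite_perfect_matching by metis
qed

text \<open>Stated for every larger \<open>F\<close> so that the interconnections of the tree can be
  added.\<close>

lemma perfect_matching_imp_state_matching:
  assumes M: "perfect_matching S M" and F: "matching_interconnections S M \<subseteq> F"
  shows "\<exists>f. state_matching (states S) (inputs S) (composite_A S F) (composite_B S) f"
proof -
  have "\<forall>p\<in>states S. \<exists>y. (p, y) \<in> M"
    using M unfolding perfect_matching_def by force
  from bchoice[OF this] obtain f where f: "\<And>p. p \<in> states S \<Longrightarrow> (p, f p) \<in> M" by blast
  have "inj_on f (states S)"
  proof (rule inj_onI)
    fix p q assume pq: "p \<in> states S" "q \<in> states S" "f p = f q"
    have "inj_on snd M" using M by (simp add: perfect_matching_def)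
    from inj_onD[OF this _ f[OF pq(1)] f[OF pq(2)]] pq(3) show "p = q" by simp
  qed
  moreover have "case f p of Inl q \<Rightarrow> q \<in> states S \<and> composite_A S F p q
      | Inr r \<Rightarrow> r \<in> inputs S \<and> composite_B S p r" if p: "p \<in> states S" for p
  proof (cases "(p, f p) \<in> bip_nbr S")
    case True
    then obtain q where q: "f p = Inl q" by (auto simp: bip_nbr_def)
    with True f[OF p] have "(q, p) \<in> matching_interconnections S M"
      unfolding matching_interconnections_def by (cases q; cases p) auto
    with F have "(q, p) \<in> F" by blast
    then show ?thesis using True q by (auto simp: bip_nbr_def)
  next
    case False
    then have "(p, f p) \<in> bip_local S" using f[OF p] M by (auto simp: perfect_matching_def)
    then show ?thesis by (auto simp: bip_local_def)
  qed
  ultimately show ?thesis unfolding state_matching_def by blast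
qed

section \<open>Components\<close>

lemma wf_state_digraph: "wf_digraph (with_proj (state_digraph S i))"
  by unfold_locales (auto simp: state_digraph_def)

lemma in_component:
  assumes "C \<in> components S i" "x \<in> C"
  shows "fst x = i" "snd x < sdim S i"
proof -
  have "x \<rightarrow>\<^sup>*\<^bsub>with_proj (state_digraph S i)\<^esub> x"
    using assms by (auto simp: components_def pre_digraph.sccs_verts_def)
  \<comment> \<open>\<open>rtrancl_on\<close> is reflexive only on its vertex set, so
    self-reachability yields membership in that set.\<close>
  then have "x \<in> pverts (state_digraph S i)"
    unfolding reachable_def by (auto dest: in_rtrancl_on_in_F)
  then show "fst x = i" "snd x < sdim S i" by (auto simp: state_digraph_def)
qed

lemma component_nonempty: "C \<in> components S i \<Longrightarrow> C \<noteq> {}"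
  by (auto simp: components_def pre_digraph.sccs_verts_def)

lemma component_subset_states: "C \<in> components S i \<Longrightarrow> i < nsys S \<Longrightarrow> C \<subseteq> states S"
  using in_component by (fastforce simp: states_def)

definition component_of :: "network \<Rightarrow> state \<Rightarrow> state set" where
  "component_of S x = pre_digraph.scc_of (with_proj (state_digraph S (fst x))) x"

lemma component_of:
  assumes "x \<in> states S"
  shows "component_of S x \<in> components S (fst x)" "x \<in> component_of S x"
proof -
  have "x \<in> verts (with_proj (state_digraph S (fst x)))"
    using assms by (cases x) (auto simp: states_def state_digraph_def)
  then show "component_of S x \<in> components S (fst x)" "x \<in> component_of S x"
    unfolding component_of_def components_def
    by (auto intro: wf_digraph.scc_of_in_sccs_verts wf_digraph.in_scc_of_self wf_state_digraph)
qed

lemma component_of_eq: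
  assumes "C \<in> components S i" "i < nsys S" "x \<in> C"
  shows "component_of S x = C"
proof (rule ccontr)
  assume ne: "component_of S x \<noteq> C"
  have x: "x \<in> states S" using component_subset_states assms by blast
  have "component_of S x \<in> components S i"
    using component_of(1)[OF x] in_component[OF assms(1,3)] by simp
  with ne assms(1) have "component_of S x \<inter> C = {}"
    unfolding components_def
    by (metis wf_digraph.sccs_verts_disjoint wf_state_digraph)
  then show False using component_of(2)[OF x] assms(3) by blast
qed

lemma finite_component_edges: "finite (parcs (component_digraph S))"
proof -
  have "C \<in> Pow (states S)" if "C \<in> components S i" "i < nsys S" for C i
    using component_subset_states[OF that] by simp
  then have "parcs (component_digraph S) \<subseteq>
      insert Master (Comp ` Pow (states S)) \<times> insert Master (Comp ` Pow (states S))"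
    unfolding component_digraph_def edges1_def edges2_def edges3_def by (auto 4 4)
  then show ?thesis by (rule finite_subset) (simp add: finite_states)
qed

text \<open>A nonempty component determines its subsystem, so the weight of an edge does not depend
  on how it is presented.\<close>

lemma edges2_disjoint: "edges2 S \<inter> (edges1 S \<union> edges3 S) = {}"
proof -
  have "i = j" if "C \<in> components S i" "C \<in> components S j" for C i j
    using that component_nonempty in_component(1) by (metis equals0I)
  then show ?thesis unfolding edges1_def edges2_def edges3_def by blast
qed

section \<open>Tree edges, selected interconnections and accessibility\<close>

lemma edges2_permitted:
  assumes "(Comp C, Comp D) \<in> edges2 S" "x \<in> C" "y \<in> D"
  shows "(x, y) \<in> permitted S"
proof -
  from assms(1) obtain i j where "i < nsys S" "j < nsys S" "C \<in> components S i"
    "D \<in> components S j" "i \<noteq> j" "j \<in> nbrs S i"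
    unfolding edges2_def by blast
  with assms(2,3) show ?thesis
    using in_component[of C S i x] in_component[of D S j y]
    by (cases x; cases y) (auto simp: permitted_def states_def)
qed

lemma selection_permitted:
  assumes "tree_selection S T sel"
  shows "sel ` (T \<inter> edges2 S) \<subseteq> permitted S"
proof
  fix e assume "e \<in> sel ` (T \<inter> edges2 S)"
  then obtain C D where "(Comp C, Comp D) \<in> T \<inter> edges2 S" "e = sel (Comp C, Comp D)"
    unfolding edges2_def by blast
  then have "e \<in> C \<times> D" "(Comp C, Comp D) \<in> edges2 S"
    using assms unfolding tree_selection_def by auto
  then show "e \<in> permitted S" using edges2_permitted by (cases e) blast
qed

lemma ex_tree_selection: "\<exists>sel. tree_selection S T sel"
proof -
  have "\<exists>s. \<forall>C D. e = (Comp C, Comp D) \<longrightarrow> e \<in> edges2 S \<longrightarrow> s \<in> C \<times> D" for e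
  proof (cases "e \<in> edges2 S")
    case True
    then obtain C D i j where "e = (Comp C, Comp D)" "C \<in> components S i" "D \<in> components S j"
      unfolding edges2_def by blast
    moreover from this obtain x y where "x \<in> C" "y \<in> D"
      using component_nonempty by (metis equals0I)
    ultimately show ?thesis by (intro exI[of _ "(x, y)"]) auto
  qed auto
  then have "\<forall>e. \<exists>s. \<forall>C D. e = (Comp C, Comp D) \<longrightarrow> e \<in> edges2 S \<longrightarrow> s \<in> C \<times> D" by blast
  from choice[OF this] show ?thesis unfolding tree_selection_def by blast
qed

lemma tree_weight_eq_card:
  assumes "T \<subseteq> parcs (component_digraph S)"
  shows "tree_weight S T = card (T \<inter> edges2 S)"
  using finite_subset[OF assms finite_component_edges]
  by (simp add: tree_weight_def flip: sum.inter_restrict)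

text \<open>A closed set meeting a component contains all of it, by strong connectivity. The set
  therefore spreads down the tree whichever end points were selected for an interconnection.\<close>

lemma spanning_tree_imp_all_accessible:
  assumes T: "directed_spanning_tree (component_digraph S) Master T"
    and sel: "tree_selection S T sel" and F: "sel ` (T \<inter> edges2 S) \<subseteq> F"
  shows "all_accessible (states S) (inputs S) (composite_A S F) (composite_B S)"
  unfolding all_accessible_def
proof (intro allI impI)
  fix Z assume Z: "Z \<subseteq> states S" and ZB: "\<forall>p\<in>states S. \<forall>r\<in>inputs S. composite_B S p r \<longrightarrow> p \<in> Z"
    and ZA: "\<forall>q\<in>Z. \<forall>p\<in>states S. composite_A S F p q \<longrightarrow> p \<in> Z"
  have arc: "y \<in> Z" if "x \<in> Z" "(x, y) \<in> parcs (state_digraph S i)" "i < nsys S" for x y i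
    using ZA that by (fastforce simp: state_digraph_def states_def)
  have local: "x \<in> Z" if "x \<in> states S" "locally_accessible S x" for x
  proof -
    define i where "i = fst x"
    have i: "i < nsys S" using that(1) by (auto simp: i_def states_def)
    from that(2) obtain r where r: "r < idim S i"
      "(Inr (i, r), Inl x) \<in> rtrancl_on (pverts (system_digraph S i)) (parcs (system_digraph S i))"
      unfolding locally_accessible_def reachable_def i_def by auto
    have "case v of Inl y \<Rightarrow> y \<in> Z | Inr _ \<Rightarrow> True"
      if "(Inr (i, r), v) \<in> rtrancl_on (pverts (system_digraph S i)) (parcs (system_digraph S i))" for v
      using that
    proof (induction rule: rtrancl_on_induct)
      case (step y z)
      then consider p q where "y = Inl (i, p)" "z = Inl (i, q)" "p < sdim S i" "q < sdim S i" "Apat S i q p"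
        | s q where "y = Inr (i, s)" "z = Inl (i, q)" "s < idim S i" "q < sdim S i" "Bpat S i q s"
        unfolding system_digraph_def by auto
      then show ?case
      proof cases
        case 1
        then show ?thesis using step.IH ZA i by (auto simp: states_def)
      next
        case 2
        then show ?thesis using ZB i by (auto simp: states_def inputs_def)
      qed
    qed simp
    from this[OF r(2)] show ?thesis by simp
  qed
  have comp: "C \<subseteq> Z" if C: "C \<in> components S i" "i < nsys S" and x: "x \<in> C" "x \<in> Z" for C i x
  proof
    fix y assume "y \<in> C"
    with C x have "(x, y) \<in> rtrancl_on (pverts (state_digraph S i)) (parcs (state_digraph S i))"
      by (auto simp: components_def pre_digraph.sccs_verts_def reachable_def)
    then show "y \<in> Z"
      by (induction rule: rtrancl_on_induct) (use x arc C in blast)+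
  qed
  define H where "H = with_proj \<lparr>pverts = pverts (component_digraph S), parcs = T\<rparr>"
  have TG: "T \<subseteq> edges1 S \<union> edges2 S \<union> edges3 S"
    using T by (simp add: directed_spanning_tree_def component_digraph_def)
  have reached: "case v of Master \<Rightarrow> True | Comp C \<Rightarrow> C \<subseteq> Z"
    if "(Master, v) \<in> rtrancl_on (verts H) (arcs_ends H)" for v
    using that
  proof (induction rule: rtrancl_on_induct)
    case (step v w)
    have vw: "(v, w) \<in> T" using step by (simp add: H_def)
    with TG consider "(v, w) \<in> edges1 S" | "(v, w) \<in> edges2 S" | "(v, w) \<in> edges3 S" by blast
    then show ?case
    proof cases
      case 1
      then obtain C D i x y where e: "v = Comp C" "w = Comp D" "i < nsys S" "D \<in> components S i"
        "x \<in> C" "y \<in> D" "(x, y) \<in> parcs (state_digraph S i)"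
        unfolding edges1_def by blast
      with step.IH have "x \<in> Z" by auto
      from arc[OF this e(7,3)] comp e show ?thesis by simp
    next
      case 2
      then obtain C D i where e: "v = Comp C" "w = Comp D" "i < nsys S" "D \<in> components S i"
        unfolding edges2_def by blast
      obtain x y where xy: "sel (v, w) = (x, y)" by (cases "sel (v, w)")
      have "(x, y) \<in> C \<times> D" using sel vw 2 e xy unfolding tree_selection_def by fastforce
      moreover have "(x, y) \<in> F" using F vw 2 xy by (metis IntI image_eqI subsetD)
      moreover have "(x, y) \<in> permitted S"
        using edges2_permitted calculation(1) 2 e by blast
      moreover have "x \<in> Z" using calculation(1) step.IH e by auto
      ultimately have "y \<in> Z" using ZA by (fastforce simp: permitted_def)
      with comp e \<open>(x, y) \<in> C \<times> D\<close> show ?thesis by simp blast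
    next
      case 3
      then obtain D i x where e: "w = Comp D" "i < nsys S" "D \<in> components S i" "x \<in> D"
        "locally_accessible S x"
        unfolding edges3_def by blast
      then have "x \<in> Z" using local component_subset_states by blast
      with comp e show ?thesis by simp
    qed
  qed simp
  have "x \<in> Z" if x: "x \<in> states S" for x
  proof -
    have "fst x < nsys S" using x by (auto simp: states_def)
    then have "Comp (component_of S x) \<in> verts H"
      using component_of(1)[OF x] by (auto simp: H_def component_digraph_def)
    then have "Master \<rightarrow>\<^sup>*\<^bsub>H\<^esub> Comp (component_of S x)"
      using T unfolding directed_spanning_tree_def Let_def H_def by blast
    from reached[OF this[unfolded reachable_def]] component_of(2)[OF x] show ?thesis by auto
  qed
  then show "Z = states S" using Z by blast
qed

text \<open>Lower bound for the second stage: contracting components turns \<open>F\<close> into at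
  most \<open>card F\<close> weighted edges. Together with the free edges they reach every
  component, so a spanning tree exists that uses no other weighted edge.\<close>

lemma all_accessible_imp_spanning_tree:
  assumes F: "F \<subseteq> permitted S"
    and acc: "all_accessible (states S) (inputs S) (composite_A S F) (composite_B S)"
  shows "\<exists>T. directed_spanning_tree (component_digraph S) Master T \<and> tree_weight S T \<le> card F"
proof -
  define lift where "lift = (\<lambda>(y, x). (Comp (component_of S y), Comp (component_of S x)))"
  define E where "E = edges1 S \<union> edges3 S \<union> lift ` F"
  have lift: "lift ` F \<subseteq> edges2 S"
  proof
    fix e assume "e \<in> lift ` F"
    then obtain y x where e: "e = lift (y, x)" "(y, x) \<in> F" by auto
    with F have p: "(y, x) \<in> permitted S" by blast
    then have "x \<in> states S" "y \<in> states S" "fst x \<noteq> fst y" "fst x \<in> nbrs S (fst y)"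
      "fst x < nsys S" "fst y < nsys S"
      by (auto simp: permitted_def states_def)
    moreover from this have "component_of S y \<in> components S (fst y)"
      "component_of S x \<in> components S (fst x)"
      using component_of(1) by blast+
    ultimately show "e \<in> edges2 S"
      unfolding e lift_def edges2_def by simp metis
  qed
  have E: "E \<subseteq> parcs (component_digraph S)"
    using lift by (auto simp: E_def component_digraph_def)
  have "parcs (component_digraph S) \<subseteq> pverts (component_digraph S) \<times> pverts (component_digraph S)"
    unfolding component_digraph_def edges1_def edges2_def edges3_def by auto
  with E have E_wf: "E \<subseteq> pverts (component_digraph S) \<times> pverts (component_digraph S)" by blast
  \<comment> \<open>Accessibility is applied to the states whose component is reached from
    \<open>Master\<close>: local edges and interconnections both preserve this set.\<close>
  have "{x \<in> states S. (Master, Comp (component_of S x)) \<in> E\<^sup>*} = states S"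
  proof (rule acc[unfolded all_accessible_def, rule_format])
    fix p r assume p: "p \<in> states S" and r: "r \<in> inputs S" and B: "composite_B S p r"
    obtain i p' r' where pr: "p = (i, p')" "r = (i, r')" "Bpat S i p' r'"
      using B by (cases p; cases r) auto
    have i: "i < nsys S" "p' < sdim S i" "r' < idim S i"
      using p r by (auto simp: pr states_def inputs_def)
    have "Inr (i, r') \<rightarrow>\<^sup>*\<^bsub>with_proj (system_digraph S i)\<^esub> Inl p"
      unfolding reachable_def
      by (rule rtrancl_on_into_rtrancl_on[OF rtrancl_on_refl]) (use i pr in \<open>auto simp: system_digraph_def\<close>)
    then have "locally_accessible S p" using i pr by (auto simp: locally_accessible_def)
    then have "(Master, Comp (component_of S p)) \<in> edges3 S"
      unfolding edges3_def using component_of[OF p] i pr by auto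
    then show "p \<in> {x \<in> states S. (Master, Comp (component_of S x)) \<in> E\<^sup>*}"
      using p by (auto simp: E_def)
  next
    fix q p assume q: "q \<in> {x \<in> states S. (Master, Comp (component_of S x)) \<in> E\<^sup>*}"
      and p: "p \<in> states S" and A: "composite_A S F p q"
    have "(Comp (component_of S q), Comp (component_of S p)) \<in> E"
    proof (cases "fst p = fst q")
      case True
      have "(q, p) \<in> parcs (state_digraph S (fst q))"
        using A True p q by (cases p; cases q) (auto simp: state_digraph_def states_def)
      moreover have "fst q < nsys S" using q by (auto simp: states_def)
      ultimately have "(Comp (component_of S q), Comp (component_of S p)) \<in> edges1 S"
        unfolding edges1_def mem_Collect_eq
        using component_of[OF p] component_of[of q S] q True
        by - (rule exI[of _ "component_of S q"], rule exI[of _ "component_of S p"],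
          rule exI[of _ "fst q"], rule exI[of _ q], rule exI[of _ p], auto)
      then show ?thesis by (simp add: E_def)
    next
      case False
      then have "(q, p) \<in> F" using A by (cases p; cases q) auto
      then show ?thesis by (force simp: E_def lift_def)
    qed
    with q p show "p \<in> {x \<in> states S. (Master, Comp (component_of S x)) \<in> E\<^sup>*}"
      by (auto intro: rtrancl_into_rtrancl)
  qed auto
  then have reach: "(Master, Comp (component_of S x)) \<in> E\<^sup>*" if "x \<in> states S" for x
    using that by blast
  have "(Master, v) \<in> E\<^sup>*" if "v \<in> pverts (component_digraph S)" for v
  proof (cases v)
    case (Comp C)
    with that obtain i where C: "C \<in> components S i" "i < nsys S" by (auto simp: component_digraph_def)
    then obtain x where x: "x \<in> C" using component_nonempty by blast
    then have "x \<in> states S" using component_subset_states C by blast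
    from reach[OF this] show ?thesis using component_of_eq[OF C x] Comp by simp
  qed simp
  moreover have "Master \<in> pverts (component_digraph S)" by (simp add: component_digraph_def)
  ultimately obtain T where T: "T \<subseteq> E" "directed_spanning_tree (component_digraph S) Master T"
    using ex_directed_spanning_tree[OF E E_wf] by blast
  have finF: "finite F" using F finite_permitted finite_subset by blast
  \<comment> \<open>Disjointness excludes the free edges. Several interconnections may contract to
    the same edge, which only lowers the count.\<close>
  have "T \<inter> edges2 S \<subseteq> lift ` F" using T(1) edges2_disjoint by (fastforce simp: E_def)
  then have "card (T \<inter> edges2 S) \<le> card F"
    using finF by (meson card_image_le card_mono finite_imageI order_trans)
  with T E show ?thesis by (metis subset_trans tree_weight_eq_card)
qed

section \<open>The approximation guarantee\<close>

lemma algorithm_output_2_optimal: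
  assumes "algorithm_output S F" "feasible S F0"
  shows "eps_optimal S 2 F"
proof -
  from assms(1) obtain M T sel where M: "min_weight_perfect_matching S M"
    and T: "min_weight_spanning_tree S T" and sel: "tree_selection S T sel"
    and F: "F = matching_interconnections S M \<union> sel ` (T \<inter> edges2 S)"
    unfolding algorithm_output_def by blast
  have pm: "perfect_matching S M"
    and pm_min: "\<And>M'. perfect_matching S M' \<Longrightarrow> matching_weight S M \<le> matching_weight S M'"
    using M unfolding min_weight_perfect_matching_def is_arg_min_def by (auto simp: not_less)
  have st: "directed_spanning_tree (component_digraph S) Master T"
    and st_min: "\<And>T'. directed_spanning_tree (component_digraph S) Master T' \<Longrightarrow>
      tree_weight S T \<le> tree_weight S T'"
    using T unfolding min_weight_spanning_tree_def is_arg_min_def by (auto simp: not_less)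
  have T_sub: "T \<subseteq> parcs (component_digraph S)"
    using st by (simp add: directed_spanning_tree_def)
  have "feasible S F"
    unfolding feasible_iff
    using matching_interconnections_permitted selection_permitted[OF sel]
      perfect_matching_imp_state_matching[OF pm, of F]
      spanning_tree_imp_all_accessible[OF st sel, of F] F
    by auto
  moreover have "card F \<le> 2 * min_interconnections S"
  proof -
    \<comment> \<open>Feasibility of \<open>F0\<close> makes the minimum range over a nonempty set,
      so some solution attains it.\<close>
    from min_interconnections_attained[OF assms(2)]
    obtain F' where F': "feasible S F'" "card F' = min_interconnections S" by blast
    from F'(1) obtain M' T' where "perfect_matching S M'" "matching_weight S M' \<le> card F'"
      "directed_spanning_tree (component_digraph S) Master T'" "tree_weight S T' \<le> card F'"
      unfolding feasible_iff
      using state_matching_imp_perfect_matching all_accessible_imp_spanning_tree by metis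
    with pm_min st_min have "matching_weight S M \<le> card F'" "tree_weight S T \<le> card F'"
      by (meson order_trans)+
    moreover have "card F \<le> card (matching_interconnections S M) + card (sel ` (T \<inter> edges2 S))"
      unfolding F by (rule card_Un_le)
    moreover have "card (sel ` (T \<inter> edges2 S)) \<le> tree_weight S T"
      using finite_subset[OF T_sub finite_component_edges]
      by (simp add: tree_weight_eq_card[OF T_sub] card_image_le)
    moreover note card_matching_interconnections[OF pm]
    ultimately show ?thesis using F'(2) by linarith
  qed
  then have "real (card F) \<le> 2 * real (min_interconnections S)" by linarith
  ultimately show ?thesis by (simp add: eps_optimal_def)
qed

text \<open>Keeps the guarantee from being vacuous: a feasible solution provides a perfect matching
  and a spanning tree, and natural-number weights have minimizers.\<close>

lemma ex_algorithm_output: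
  assumes "feasible S F"
  shows "\<exists>F'. algorithm_output S F'"
proof -
  obtain M0 T0 where M0: "perfect_matching S M0"
    and T0: "directed_spanning_tree (component_digraph S) Master T0"
    using assms state_matching_imp_perfect_matching all_accessible_imp_spanning_tree
    unfolding feasible_iff by metis
  obtain M where "min_weight_perfect_matching S M"
    using ex_has_least_nat[of "perfect_matching S" M0 "matching_weight S"] M0
    unfolding min_weight_perfect_matching_def is_arg_min_def by (auto simp: not_less)
  moreover obtain T where "min_weight_spanning_tree S T"
    using ex_has_least_nat[of "directed_spanning_tree (component_digraph S) Master" T0 "tree_weight S"] T0
    unfolding min_weight_spanning_tree_def is_arg_min_def by (auto simp: not_less)
  moreover obtain sel where "tree_selection S T sel" using ex_tree_selection by blast
  ultimately show ?thesis unfolding algorithm_output_def by blast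
qed

theorem theoremV8:
  fixes S :: network
  assumes nbrs: "\<forall>j < nsys S. nbrs S j \<subseteq> {..<nsys S}"
    and B_nonzero: "\<exists>x \<in> states S. \<exists>u \<in> inputs S. composite_B S x u"
    and all_permitted: "structurally_controllable (states S) (inputs S)
           (composite_A S (permitted S)) (composite_B S)"
  shows "(\<exists>F. algorithm_output S F) \<and>
         (\<forall>F. algorithm_output S F \<longrightarrow> eps_optimal S 2 F)"
proof -
  have "feasible S (permitted S)"
    using all_permitted by (simp add: feasible_def)
  then show ?thesis
    using ex_algorithm_output algorithm_output_2_optimal by blast
qed

end
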